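(* Let $p\in[0,1]$ and let $S$ be an elephant random walk on $\mathbb{Z}$ with parameter $p$. Then $S$ is recurrent if $p\le 3/4$, and $S$ is transient if $p>3/4$.
   Context: Elephant random walk (ERW) on $\mathbb{Z}$ with parameter $p\in[0,1]$: $S_0=0$, $S_1=\sigma_1=1$. For each $n\ge1$, choose $n'$ uniformly at random in $\{1,\dots,n\}$ (independently of the past); given the past and $n'$, let $\sigma_{n+1}=\sigma_{n'}$ with probability $p$ and $\sigma_{n+1}=-\sigma_{n'}$ with probability $1-p$. Set $S_{n+1}=S_n+\sigma_{n+1}$. A random walk $(S_n)$ on $\mathbb{Z}$ is called recurrent if for every $x\in\mathbb{Z}$, $\mathbb{P}(S_n=x\text{ for infinitely many }n)=1$, and transient if for every $x\in\mathbb{Z}$, $\mathbb{P}(S_n=x\text{ for only finitely many }n)=1$. *)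

theory Defs
  imports "HOL-Probability.Probability"
begin

text \<open>
  The past at time \<open>n\<close>: the steps \<open>\<sigma> 1, \<dots>, \<sigma> n\<close> together with the indices
  \<open>\<nu> 1, \<dots>, \<nu> (n - 1)\<close> recalled so far. It takes values in a countable type, so conditioning on
  the past amounts to elementary conditioning on its values of positive probability.
\<close>

definition erw_past :: "(nat \<Rightarrow> 'w \<Rightarrow> int) \<Rightarrow> (nat \<Rightarrow> 'w \<Rightarrow> nat) \<Rightarrow> nat \<Rightarrow> 'w \<Rightarrow> int list \<times> nat list"
  where "erw_past \<sigma> \<nu> n w = (map (\<lambda>i. \<sigma> i w) [1..<Suc n], map (\<lambda>i. \<nu> i w) [1..<n])"

text \<open>
  \<open>\<nu> n\<close> is the index recalled just before step \<open>n + 1\<close>, the \<open>n'\<close> of the usual description.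
  The values \<open>\<sigma> 0\<close> and \<open>\<nu> 0\<close> play no role.
  Independence of \<open>\<nu> n\<close> and the past is that of the generated \<open>\<sigma>\<close>-algebras, because
  \<open>indep_var\<close> requires both variables to have the same value type.
\<close>

locale elephant_random_walk = prob_space M
  for M :: "'w measure" and p :: real
    and \<sigma> :: "nat \<Rightarrow> 'w \<Rightarrow> int" and \<nu> :: "nat \<Rightarrow> 'w \<Rightarrow> nat" and S :: "nat \<Rightarrow> 'w \<Rightarrow> int" +
  assumes parameter: "0 \<le> p" "p \<le> 1"
    and step_measurable: "\<And>n. n \<ge> 1 \<Longrightarrow> \<sigma> n \<in> measurable M (count_space UNIV)"
    and index_measurable: "\<And>n. n \<ge> 1 \<Longrightarrow> \<nu> n \<in> measurable M (count_space UNIV)"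
    and step_1: "\<And>w. w \<in> space M \<Longrightarrow> \<sigma> 1 w = 1"
    and index_uniform: "\<And>n. n \<ge> 1 \<Longrightarrow>
          distr M (count_space UNIV) (\<nu> n) = measure_pmf (pmf_of_set {1..n})"
    and index_indep: "\<And>n. n \<ge> 1 \<Longrightarrow>
          indep_set (sets (vimage_algebra (space M) (\<nu> n) (count_space UNIV)))
            (sets (vimage_algebra (space M) (erw_past \<sigma> \<nu> n) (count_space UNIV)))"
    and step_same: "\<And>n h k. n \<ge> 1 \<Longrightarrow>
          \<P>(w in M. erw_past \<sigma> \<nu> n w = h \<and> \<nu> n w = k) > 0 \<Longrightarrow>
          \<P>(w in M. \<sigma> (Suc n) w = \<sigma> (\<nu> n w) w \<bar> erw_past \<sigma> \<nu> n w = h \<and> \<nu> n w = k) = p"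
    and step_opposite: "\<And>n h k. n \<ge> 1 \<Longrightarrow>
          \<P>(w in M. erw_past \<sigma> \<nu> n w = h \<and> \<nu> n w = k) > 0 \<Longrightarrow>
          \<P>(w in M. \<sigma> (Suc n) w = - \<sigma> (\<nu> n w) w \<bar> erw_past \<sigma> \<nu> n w = h \<and> \<nu> n w = k) = 1 - p"
    and walk_0: "\<And>w. w \<in> space M \<Longrightarrow> S 0 w = 0"
    and walk_Suc: "\<And>n w. w \<in> space M \<Longrightarrow> S (Suc n) w = S n w + \<sigma> (Suc n) w"

definition recurrent_walk :: "'w measure \<Rightarrow> (nat \<Rightarrow> 'w \<Rightarrow> int) \<Rightarrow> bool"
  where "recurrent_walk M S \<longleftrightarrow> (\<forall>x. \<P>(w in M. infinite {n. S n w = x}) = 1)"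

definition transient_walk :: "'w measure \<Rightarrow> (nat \<Rightarrow> 'w \<Rightarrow> int) \<Rightarrow> bool"
  where "transient_walk M S \<longleftrightarrow> (\<forall>x. \<P>(w in M. finite {n. S n w = x}) = 1)"

end

theory Submission
  imports Defs
begin

text \<open>
  Put \<open>a = 2 * p - 1\<close>. Averaging over the recalled index shows that, given the past, the walk steps
  up from \<open>s\<close> at time \<open>n\<close> with probability \<open>(1 + a * s / n) / 2\<close> (\<open>step_law\<close>). In the variables
  \<open>y = S n / sqrt n\<close> and \<open>ln n\<close> this is approximately the diffusion \<open>dy = (a - 1 / 2) * y * dt + dB\<close>, whose
  drift points away from the origin exactly when \<open>a > 1 / 2\<close>, that is, \<open>p > 3 / 4\<close>. Both halves follow
  from Lyapunov functions of \<open>y\<close> that decrease in mean by order \<open>1 / n\<close> at each step from a bounded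
  region of \<open>y\<close>. As the harmonic series diverges, that region must be improbable at arbitrarily late
  times (\<open>exists_small_of_harmonic_decrease\<close>).

  For \<open>p > 3 / 4\<close> the function \<open>1 / (1 + K * y\<^sup>2)\<close> is a supermartingale at late times, strict on \<open>\<bar>y\<bar> \<le> 1\<close>
  (\<open>transition_escape_fun\<close>). So at some late time \<open>\<bar>y\<bar> > 1\<close> with probability close to \<open>1\<close>, and the
  supermartingale is then bounded away from \<open>1\<close>. At any later visit to a fixed \<open>x\<close> it is almost \<open>1\<close>, so
  by the maximal inequality infinitely many visits have conditional probability at most some \<open>c < 1\<close>,
  whatever the past (\<open>infinite_visits_deficit\<close>). An event which is approximated by events of the past
  and has this property is null (\<open>visits_forever_null_of_deficit\<close>).

  For \<open>p \<le> 3 / 4\<close> consider the walk until it hits the origin. The scaled distance \<open>\<bar>y\<bar>\<close> is a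
  supermartingale, up to a small change of the scale (\<open>transition_scaled_abs\<close>), and so is unlikely to
  be large; the concave function \<open>\<bar>y\<bar> / (1 + \<bar>y\<bar>)\<close> decreases by order \<open>1 / n\<close> where \<open>\<bar>y\<bar>\<close> is bounded
  (\<open>transition_concave_fun\<close>), so \<open>\<bar>y\<bar>\<close> cannot stay bounded either. Hence the origin is hit after any
  time, almost surely (\<open>origin_visited_forever\<close>). Infinitely many visits pass on from a site to its
  neighbours, because each visit is followed by a step to a given neighbour with probability at least
  \<open>1 / 4\<close> at late times (\<open>neighbour_visited_forever\<close>).
\<close>

section \<open>One-step means and Lyapunov functions\<close>

text \<open>
  The mean of \<open>g\<close> after one step of the walk from position \<open>s\<close> at time \<open>n\<close>, with \<open>a = 2 * p - 1\<close>.
\<close>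

definition transition :: "real \<Rightarrow> nat \<Rightarrow> (int \<Rightarrow> real) \<Rightarrow> int \<Rightarrow> real"
  where "transition a n g s = (1 + a * s / n) / 2 * g (s + 1) + (1 - a * s / n) / 2 * g (s - 1)"

text \<open>
  This is \<open>1 / (1 + K * y\<^sup>2)\<close> in the diffusive variable \<open>y = s / sqrt n\<close>: close to \<open>1\<close> at
  bounded positions and late times, and close to \<open>0\<close> far outside the diffusive scale.
\<close>

definition escape_fun :: "real \<Rightarrow> nat \<Rightarrow> int \<Rightarrow> real"
  where "escape_fun K n s = n / (n + K * (real_of_int s)\<^sup>2)"

text \<open>
  In the time \<open>ln n\<close> the variable \<open>y\<close> is approximately a diffusion with generator
  \<open>f'' / 2 + (a - 1 / 2) * y * f'\<close>. Applied to \<open>1 / (1 + K * y\<^sup>2)\<close> the generator is negative as soon as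
  \<open>3 * K \<le> 2 * a - 1\<close>; asking for \<open>4 * K\<close> leaves room for the discretisation error when
  \<open>n \<ge> (1 + K) / K\<close>. Since a unit of the time \<open>ln n\<close> consists of about \<open>n\<close> steps, a strictly negative
  generator on \<open>\<bar>y\<bar> \<le> 1\<close> gives a decrease of order \<open>1 / n\<close> there. The proof clears denominators and
  identifies the remaining polynomial \<open>X\<close>.
\<close>

lemma transition_escape_fun:
  fixes K a :: real and s :: int
  assumes K: "0 < K" "4 * K \<le> 2 * a - 1" and n: "n \<ge> 1" "(1 + K) / K \<le> n" and s: "\<bar>s\<bar> \<le> int n"
  shows "transition a n (escape_fun K (Suc n)) s
    \<le> escape_fun K n s - (if s\<^sup>2 \<le> int n then K / (4 * (1 + K) ^ 3) / n else 0)"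
proof -
  define x where "x = real_of_int s"
  define u where "u = x\<^sup>2"
  define N where "N = real n"
  define A where "A = N + 1 + K + K * u"
  define Q where "Q = A\<^sup>2 - 4 * K\<^sup>2 * u"
  define X where "X = A * (N - u) - 4 * K * N * u + 2 * a * u * (N + 1) * (N + K * u) / N"
  have N1: "N \<ge> 1" and NK: "1 + K \<le> K * N" and u0: "u \<ge> 0"
    using n K by (auto simp: N_def u_def field_simps)
  have pos: "N + 1 + K * (x + 1)\<^sup>2 > 0" "N + 1 + K * (x - 1)\<^sup>2 > 0" "N + K * u > 0"
    using N1 K by (auto simp: u_def intro!: add_pos_nonneg)
  have Q_eq: "Q = (N + 1 + K * (x + 1)\<^sup>2) * (N + 1 + K * (x - 1)\<^sup>2)"
    by (simp add: Q_def A_def u_def power2_eq_square algebra_simps)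
  have Q0: "Q > 0" unfolding Q_eq using pos by simp
  have "transition a n (escape_fun K (Suc n)) s = (N + 1) * (A - 2 * K * a * u / N) / Q"
  proof -
    have "(N + 1) / (N + 1 + K * (x + 1)\<^sup>2) = (N + 1) * (N + 1 + K * (x - 1)\<^sup>2) / Q"
      "(N + 1) / (N + 1 + K * (x - 1)\<^sup>2) = (N + 1) * (N + 1 + K * (x + 1)\<^sup>2) / Q"
      unfolding Q_eq using pos by simp_all
    then have "transition a n (escape_fun K (Suc n)) s =
       (1 + a * x / N) / 2 * ((N + 1) * (N + 1 + K * (x - 1)\<^sup>2) / Q)
       + (1 - a * x / N) / 2 * ((N + 1) * (N + 1 + K * (x + 1)\<^sup>2) / Q)"
      by (simp add: transition_def escape_fun_def x_def N_def add.commute)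
    also have "\<dots> = ((1 + a * x / N) / 2 * ((N + 1) * (N + 1 + K * (x - 1)\<^sup>2))
       + (1 - a * x / N) / 2 * ((N + 1) * (N + 1 + K * (x + 1)\<^sup>2))) / Q"
      by (simp add: add_divide_distrib)
    also have "(1 + a * x / N) / 2 * ((N + 1) * (N + 1 + K * (x - 1)\<^sup>2))
       + (1 - a * x / N) / 2 * ((N + 1) * (N + 1 + K * (x + 1)\<^sup>2)) = (N + 1) * (A - 2 * K * a * u / N)"
      using N1 by (simp add: A_def u_def field_simps power2_eq_square)
    finally show ?thesis .
  qed
  moreover have "escape_fun K n s = N / (N + K * u)"
    by (simp add: escape_fun_def N_def u_def x_def)
  moreover have "N / (N + K * u) - (N + 1) * (A - 2 * K * a * u / N) / Q = K * X / ((N + K * u) * Q)"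
  proof -
    have "N * Q - (N + 1) * (A - 2 * K * a * u / N) * (N + K * u) = K * X"
      using N1 unfolding Q_def X_def A_def by (simp add: field_simps power2_eq_square)
    then show ?thesis using pos Q0 by (simp add: diff_frac_eq)
  qed
  ultimately have diff: "escape_fun K n s - transition a n (escape_fun K (Suc n)) s
      = K * X / ((N + K * u) * Q)" by simp
  have X: "X \<ge> N\<^sup>2"
  proof -
    have a0: "a \<ge> 0" using K by simp
    have "2 * a * u * (N + K * u) \<le> 2 * a * u * (N + 1) * (N + K * u) / N"
    proof -
      have "2 * a * u * (N + K * u) * N \<le> 2 * a * u * (N + K * u) * (N + 1)"
        using a0 u0 pos N1 by (intro mult_left_mono) auto
      then show ?thesis using N1 by (simp add: field_simps)
    qed
    then have "X \<ge> A * (N - u) - 4 * K * N * u + 2 * a * u * (N + K * u)"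
      unfolding X_def by simp
    also have "A * (N - u) - 4 * K * N * u + 2 * a * u * (N + K * u) =
      N\<^sup>2 + (2 * a - 1 - 4 * K) * (u * N) + (2 * a - 1) * K * u\<^sup>2 + (1 + K) * N + u * (K * N - (1 + K))"
      unfolding A_def by (simp add: algebra_simps power2_eq_square)
    finally have "N\<^sup>2 + (2 * a - 1 - 4 * K) * (u * N) + (2 * a - 1) * K * u\<^sup>2 + (1 + K) * N + u * (K * N - (1 + K)) \<le> X" .
    moreover have "0 \<le> (2 * a - 1 - 4 * K) * (u * N)" "0 \<le> (2 * a - 1) * K * u\<^sup>2" "0 \<le> (1 + K) * N"
       "0 \<le> u * (K * N - (1 + K))"
      using K u0 N1 NK by auto
    ultimately show ?thesis by linarith
  qed
  then have X0: "X \<ge> 0" by (rule order_trans[OF zero_le_power2])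
  show ?thesis
  proof (cases "s\<^sup>2 \<le> int n")
    case False
    have "0 \<le> K * X / ((N + K * u) * Q)"
      using K X0 pos Q0 by (intro divide_nonneg_nonneg mult_nonneg_nonneg) auto
    with diff False show ?thesis by simp
  next
    case True
    then have "real_of_int (s\<^sup>2) \<le> real_of_int (int n)" by (simp only: of_int_le_iff)
    then have uN: "u \<le> N" by (simp add: u_def x_def N_def)
    then have KuN: "K * u \<le> K * N" using K by simp
    have "Q \<le> A\<^sup>2" unfolding Q_def using K u0 by simp
    also have "A \<le> 2 * (1 + K) * N"
    proof -
      have "K \<le> K * N" using N1 K by simp
      then have "A \<le> 2 * N + 2 * (K * N)" unfolding A_def using KuN N1 by linarith
      then show ?thesis by (simp add: algebra_simps)
    qed
    then have "A\<^sup>2 \<le> (2 * (1 + K) * N)\<^sup>2"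
      using N1 K u0 by (intro power_mono) (auto simp: A_def)
    also have "\<dots> = 4 * (1 + K)\<^sup>2 * N\<^sup>2" by (simp only: power_mult_distrib) simp
    finally have QN: "Q \<le> 4 * (1 + K)\<^sup>2 * N\<^sup>2" .
    have "(N + K * u) * Q \<le> ((1 + K) * N) * (4 * (1 + K)\<^sup>2 * N\<^sup>2)"
      using KuN QN Q0 K N1 by (intro mult_mono) (auto simp: algebra_simps)
    also have "\<dots> = 4 * (1 + K) ^ 3 * N ^ 3" by (simp add: power2_eq_square power3_eq_cube)
    finally have den: "(N + K * u) * Q \<le> 4 * (1 + K) ^ 3 * N ^ 3" .
    have "K / (4 * (1 + K) ^ 3) / N = K * N\<^sup>2 / (4 * (1 + K) ^ 3 * N ^ 3)"
      using N1 by (simp add: power2_eq_square power3_eq_cube)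
    also have "\<dots> \<le> K * X / ((N + K * u) * Q)"
      using den X X0 K N1 pos Q0 by (intro frac_le mult_left_mono) auto
    finally show ?thesis using diff True by (simp add: N_def)
  qed
qed

text \<open>
  A substitute for \<open>sqrt n\<close>. The shift by \<open>1 / 2\<close> makes it grow at least by the factor
  \<open>1 + 1 / (2 * n)\<close> in a step, and that is the factor by which the drift of the walk increases the
  mean distance from the origin when \<open>a = 1 / 2\<close>; \<open>sqrt n\<close> itself grows slightly less.
\<close>

definition spread :: "nat \<Rightarrow> real"
  where "spread n = sqrt (n - 1 / 2)"

lemma spread_square:
  assumes "n \<ge> 1"
  shows "(spread n)\<^sup>2 = n - 1 / 2"
proof -
  have "real n - 1 / 2 \<ge> 0" using assms by linarith
  then show ?thesis by (simp add: spread_def)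
qed

lemma spread_pos:
  assumes "n \<ge> 1"
  shows "spread n > 0"
proof -
  have "real n - 1 / 2 > 0" using assms by linarith
  then show ?thesis by (simp add: spread_def)
qed

lemma spread_growth_ge:
  assumes "n \<ge> 1"
  shows "spread n * (1 + 1 / (2 * real n)) \<le> spread (Suc n)"
proof (rule power2_le_imp_le)
  have "(spread n * (1 + 1 / (2 * real n)))\<^sup>2 = (real n - 1 / 2) * (1 + 1 / (2 * real n))\<^sup>2"
    using assms by (simp add: power_mult_distrib spread_square)
  also have "\<dots> \<le> real n + 1 / 2"
    using assms by (simp add: power2_eq_square field_simps)
  finally show "(spread n * (1 + 1 / (2 * real n)))\<^sup>2 \<le> (spread (Suc n))\<^sup>2"
    by (simp add: spread_square)
qed (use spread_pos[of "Suc n"] in simp)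

lemma spread_growth_le:
  assumes "n \<ge> 1"
  shows "2 * spread n * (spread (Suc n) - spread n) \<le> 1"
proof -
  have "(spread (Suc n) - spread n)\<^sup>2 \<ge> 0" by simp
  moreover have "spread (Suc n) ^ 2 = spread n ^ 2 + 1"
    using assms by (simp add: spread_square)
  ultimately show ?thesis by (simp add: power2_eq_square algebra_simps)
qed

lemma transition_even:
  assumes "\<And>s. g (- s) = g s"
  shows "transition a n g s = transition a n g \<bar>s\<bar>"
proof (cases "s \<ge> 0")
  case False
  have "g (- s + 1) = g (s - 1)" "g (- s - 1) = g (s + 1)"
    using assms[of "s - 1"] assms[of "s + 1"] by simp_all
  then show ?thesis using False
    by (simp add: transition_def)
qed simp

definition scaled_abs :: "nat \<Rightarrow> int \<Rightarrow> real"
  where "scaled_abs n s = \<bar>real_of_int s\<bar> / spread n"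

text \<open>
  Off the origin the distance \<open>\<bar>s\<bar>\<close> performs the same walk, and its mean grows by the factor
  \<open>1 + a / n\<close>, which the growth of \<open>spread\<close> absorbs.
\<close>

lemma transition_scaled_abs:
  assumes n: "n \<ge> 1" and a: "a \<le> 1 / 2" and s: "s \<noteq> 0"
  shows "transition a n (scaled_abs (Suc n)) s \<le> scaled_abs n s"
proof -
  define x where "x = real_of_int \<bar>s\<bar>"
  have x: "x \<ge> 1" using s by (simp add: x_def)
  have "transition a n (scaled_abs (Suc n)) s = transition a n (scaled_abs (Suc n)) \<bar>s\<bar>"
    by (rule transition_even) (simp add: scaled_abs_def)
  also have "\<dots> = (1 + a * x / n) / 2 * ((x + 1) / spread (Suc n)) + (1 - a * x / n) / 2 * ((x - 1) / spread (Suc n))"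
    using s by (auto simp: transition_def scaled_abs_def x_def)
  also have "\<dots> = x * (1 + a / n) / spread (Suc n)"
    using n spread_pos[of "Suc n"] by (simp add: field_simps)
  also have "\<dots> \<le> x * (1 + 1 / (2 * real n)) / spread (Suc n)"
    using x a n spread_pos[of "Suc n"] by (intro divide_right_mono mult_left_mono) (auto simp: field_simps)
  also have "\<dots> \<le> x / spread n"
    using spread_growth_ge[OF n] x spread_pos[of n] spread_pos[of "Suc n"] n
    by (simp add: divide_simps) (simp add: algebra_simps)
  finally show ?thesis by (simp add: scaled_abs_def x_def)
qed

text \<open>
  The function \<open>y / (1 + y)\<close> of the scaled distance \<open>y = \<bar>s\<bar> / spread n\<close>.
\<close>

definition concave_fun :: "nat \<Rightarrow> int \<Rightarrow> real"
  where "concave_fun n s = \<bar>real_of_int s\<bar> / (\<bar>real_of_int s\<bar> + spread n)"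

text \<open>
  A strictly concave increasing function of a supermartingale decreases in mean by the variance of
  the increment times the curvature. A step changes the scaled distance by about \<open>1 / sqrt n\<close>, so the
  decrease is of order \<open>1 / n\<close> wherever the curvature is bounded below, that is, for scaled distances
  up to \<open>R\<close>.
\<close>

lemma transition_concave_fun:
  assumes n: "n \<ge> 3" and a: "a \<le> 1 / 2" and s: "s \<noteq> 0" "\<bar>s\<bar> \<le> int n" and R: "R > 0"
  shows "transition a n (concave_fun (Suc n)) s
    \<le> concave_fun n s - (if real_of_int \<bar>s\<bar> \<le> R * spread n then 1 / (2 * (R + 2) ^ 3) / n else 0)"
proof -
  define x where "x = real_of_int \<bar>s\<bar>"
  define N where "N = real n"
  define d where "d = spread n"
  define e where "e = spread (Suc n) - spread n"
  define \<theta> where "\<theta> = a * x / N"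
  define Q where "Q = x + d"
  define D where "D = x + (d + e)"
  have x: "x \<ge> 1" "x \<le> N" using s unfolding x_def N_def by linarith+
  have N: "N \<ge> 3" using n by (simp add: N_def)
  have d2: "d\<^sup>2 = N - 1 / 2" using n by (simp add: d_def N_def spread_square)
  have d0: "d > 0" using n spread_pos[of n] by (simp add: d_def)
  have d1: "d \<ge> 1" using d2 N d0 by (intro power2_le_imp_le[of 1 d]) auto
  have e1: "2 * d * e \<le> 1" using spread_growth_le[of n] n by (simp add: d_def e_def)
  have e2: "d \<le> 2 * N * e" using spread_growth_ge[of n] n N by (simp add: d_def e_def N_def field_simps)
  have "2 * N * e > 0" using e2 d0 by linarith
  then have e0: "e > 0" using N by (simp add: zero_less_mult_iff)
  have "e * 1 \<le> e * (2 * d)" using e0 d1 by (intro mult_left_mono) auto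
  then have e3: "e \<le> d" using e1 d1 by (simp add: mult_ac)
  have \<theta>: "\<theta> \<le> x / (2 * N)"
    using a x N mult_right_mono[OF a, of x] by (simp add: \<theta>_def field_simps)
  have "D > 1" using x d0 e0 by (simp add: D_def)
  then have D2: "D\<^sup>2 - 1 > 0" by simp
  have D2_eq: "D\<^sup>2 - 1 = (D + 1) * (D - 1)" by (simp add: power2_eq_square algebra_simps)
  have xD: "x = D - (d + e)" by (simp add: D_def)
  have "transition a n (concave_fun (Suc n)) s
      = transition a n (concave_fun (Suc n)) \<bar>s\<bar>"
    by (rule transition_even) (simp add: concave_fun_def)
  also have "\<dots> = (1 + \<theta>) / 2 * ((x + 1) / (D + 1)) + (1 - \<theta>) / 2 * ((x - 1) / (D - 1))"
    using s by (auto simp: transition_def concave_fun_def x_def \<theta>_def N_def D_def d_def e_def algebra_simps)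
  also have "(x + 1) / (D + 1) = 1 - (d + e) * (D - 1) / (D\<^sup>2 - 1)"
    unfolding D2_eq xD using \<open>D > 1\<close> by (simp add: divide_simps)
  also have "(x - 1) / (D - 1) = 1 - (d + e) * (D + 1) / (D\<^sup>2 - 1)"
    unfolding D2_eq xD using \<open>D > 1\<close> by (simp add: divide_simps)
  also have "(1 + \<theta>) / 2 * (1 - (d + e) * (D - 1) / (D\<^sup>2 - 1)) + (1 - \<theta>) / 2 * (1 - (d + e) * (D + 1) / (D\<^sup>2 - 1))
     = 1 - (d + e) * (D - \<theta>) / (D\<^sup>2 - 1)"
    using D2 by (simp add: divide_simps) (simp add: algebra_simps)
  finally have T: "transition a n (concave_fun (Suc n)) s = 1 - (d + e) * (D - \<theta>) / (D\<^sup>2 - 1)" .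
  have F: "concave_fun n s = 1 - d / Q"
    using x d0 by (simp add: concave_fun_def x_def d_def Q_def field_simps)
  have diff: "concave_fun n s - transition a n (concave_fun (Suc n)) s
    = ((d + e) * (D - \<theta>) * Q - d * (D\<^sup>2 - 1)) / ((D\<^sup>2 - 1) * Q)"
  proof -
    have "Q > 0" using x d0 by (simp add: Q_def)
    then show ?thesis unfolding T F using D2 by (simp add: diff_frac_eq mult_ac)
  qed
  have num: "(d + e) * (D - \<theta>) * Q - d * (D\<^sup>2 - 1) \<ge> d / 2"
  proof -
    \<comment> \<open>The first term is nonnegative because the growth \<open>e\<close> of the scale absorbs the drift; the term \<open>d\<close> comes
      from the variance of the step and dominates the last one, which is of second order.\<close>
    have "(d + e) * (D - \<theta>) * Q - d * (D\<^sup>2 - 1) = Q * (e * x - d * \<theta>) + x * e\<^sup>2 + d - Q * e * \<theta>"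
      unfolding D_def Q_def by (simp add: power2_eq_square algebra_simps)
    moreover have "Q * (e * x - d * \<theta>) \<ge> 0"
    proof -
      have "d * \<theta> \<le> d * (x / (2 * N))" using \<theta> d0 by (intro mult_left_mono) auto
      also have "\<dots> = d * x / (2 * N)" by simp
      also have "\<dots> \<le> (2 * N * e) * x / (2 * N)"
        using e2 x N by (intro divide_right_mono mult_right_mono) auto
      also have "\<dots> = e * x" using N by simp
      finally show ?thesis using x d0 by (simp add: Q_def)
    qed
    moreover have "x * e\<^sup>2 \<ge> 0" using x by simp
    moreover have "Q * e * \<theta> \<le> d / 2"
    proof -
      \<comment> \<open>This inequality fails for \<open>n = 1\<close> and \<open>n = 2\<close>.\<close>
      have dN: "d \<le> N - 1"
      proof (rule power2_le_imp_le)
        have "(N - 1)\<^sup>2 - d\<^sup>2 = (N - 3) * N + 3 / 2"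
          unfolding d2 by (simp add: power2_eq_square algebra_simps)
        moreover have "(N - 3) * N \<ge> 0" using N by simp
        ultimately show "d\<^sup>2 \<le> (N - 1)\<^sup>2" by linarith
      qed (use N in simp)
      have "\<theta> \<le> 1 / 2"
      proof -
        have "x / (2 * N) \<le> 1 / 2" using x N by (simp add: field_simps)
        then show ?thesis using \<theta> by linarith
      qed
      then have "Q * e * \<theta> \<le> Q * e * (1 / 2)"
        using x d0 e0 by (intro mult_left_mono) (auto simp: Q_def)
      moreover have "Q * e \<le> d"
      proof -
        have "Q * e * (2 * d) \<le> Q * 1" using e1 x d0 by (subst mult.assoc) (intro mult_left_mono, auto simp: Q_def mult_ac)
        also have "Q \<le> N + (N - 1)" using x dN by (simp add: Q_def)
        also have "\<dots> = 2 * d\<^sup>2" unfolding d2 by simp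
        also have "\<dots> = d * (2 * d)" by (simp add: power2_eq_square)
        finally show ?thesis using d0 by simp
      qed
      ultimately show ?thesis by simp
    qed
    ultimately show ?thesis by linarith
  qed
  show ?thesis
  proof (cases "real_of_int \<bar>s\<bar> \<le> R * spread n")
    case False
    have "0 \<le> ((d + e) * (D - \<theta>) * Q - d * (D\<^sup>2 - 1)) / ((D\<^sup>2 - 1) * Q)"
      using num d0 D2 x by (intro divide_nonneg_nonneg) (auto simp: Q_def)
    with diff False show ?thesis by simp
  next
    case True
    then have xR: "x \<le> R * d" by (simp add: x_def d_def)
    have "D \<le> (R + 2) * d" using xR e3 by (simp add: D_def algebra_simps)
    then have "D\<^sup>2 \<le> ((R + 2) * d)\<^sup>2" using \<open>D > 1\<close> by (intro power_mono) auto
    moreover have "Q \<le> (R + 2) * d" using xR d0 by (simp add: Q_def algebra_simps)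
    ultimately have "(D\<^sup>2 - 1) * Q \<le> ((R + 2) * d)\<^sup>2 * ((R + 2) * d)"
      using D2 x d0 by (intro mult_mono) (auto simp: Q_def)
    also have "\<dots> = (R + 2) ^ 3 * d * d\<^sup>2" by (simp add: power2_eq_square power3_eq_cube)
    also have "\<dots> \<le> (R + 2) ^ 3 * d * N" using d0 R d2 by (intro mult_left_mono) auto
    finally have den: "(D\<^sup>2 - 1) * Q \<le> (R + 2) ^ 3 * d * N" .
    have "1 / (2 * (R + 2) ^ 3) / N = (d / 2) / ((R + 2) ^ 3 * d * N)"
      using d0 by simp
    also have "\<dots> \<le> ((d + e) * (D - \<theta>) * Q - d * (D\<^sup>2 - 1)) / ((D\<^sup>2 - 1) * Q)"
      using num den d0 D2 x by (intro frac_le) (auto simp: Q_def)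
    finally show ?thesis using diff True by (simp add: N_def)
  qed
qed

text \<open>
  The nonnegative quantity \<open>u\<close> pays \<open>c * q k / k\<close> at time \<open>k\<close>, and the harmonic series diverges.
\<close>

lemma exists_small_of_harmonic_decrease:
  fixes u q :: "nat \<Rightarrow> real"
  assumes u: "\<And>k. k \<ge> m \<Longrightarrow> u k \<ge> 0" and c: "c > 0" and \<delta>: "\<delta> > 0"
    and dec: "\<And>k. k \<ge> m \<Longrightarrow> u (Suc k) \<le> u k - c / k * q k"
  shows "\<exists>k\<ge>m. q k < \<delta>"
proof (rule ccontr)
  assume "\<not> ?thesis"
  then have q: "q k \<ge> \<delta>" if "k \<ge> m" for k using that by (auto simp: not_less)
  have bound: "u (m + j) \<le> u m - c * \<delta> * (\<Sum>i<j. inverse (real (m + i)))" for j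
  proof (induction j)
    case (Suc j)
    have "u (m + Suc j) \<le> u (m + j) - c / real (m + j) * q (m + j)" using dec[of "m + j"] by simp
    also have "\<dots> \<le> u (m + j) - c / real (m + j) * \<delta>"
      using q[of "m + j"] c by (intro diff_left_mono mult_left_mono) auto
    finally show ?case using Suc by (simp add: algebra_simps divide_inverse)
  qed simp
  then have "(\<Sum>i<j. inverse (real (m + i))) \<le> u m / (c * \<delta>)" for j
  proof -
    have "c * \<delta> * (\<Sum>i<j. inverse (real (m + i))) \<le> u m"
      using bound[of j] u[of "m + j"] by simp
    then show ?thesis using c \<delta> by (simp add: pos_le_divide_eq mult.commute)
  qed
  then have "summable (\<lambda>i. inverse (real (m + i)))"
    by (intro summableI_nonneg_bounded) auto
  then have "summable (\<lambda>i. inverse (real i))"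
    by (subst summable_iff_shift[symmetric, of _ m]) (simp add: add.commute)
  then show False using not_summable_harmonic[where 'a=real] by simp
qed

section \<open>The law of the next step given the past\<close>

lemma measurable_list_map:
  assumes "\<And>i. i \<in> set ks \<Longrightarrow> f i \<in> measurable N (count_space UNIV)"
  shows "(\<lambda>w. map (\<lambda>i. f i w :: 'b::countable) ks) \<in> measurable N (count_space UNIV)"
  using assms
proof (induction ks)
  case (Cons i ks)
  have [measurable]: "f i \<in> measurable N (count_space UNIV)"
    "(\<lambda>w. map (\<lambda>i. f i w) ks) \<in> measurable N (count_space UNIV)"
    using Cons by auto
  show ?case
    by simp measurable
qed simp

context elephant_random_walk
begin

definition past :: "nat \<Rightarrow> 'w measure"
  where "past n = vimage_algebra (space M) (erw_past \<sigma> \<nu> n) (count_space UNIV)"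

lemma space_past [simp]: "space (past n) = space M"
  by (simp add: past_def)

lemma sets_past: "sets (past n) = {{w \<in> space M. erw_past \<sigma> \<nu> n w \<in> H} |H. True}"
  unfolding past_def by (subst sets_vimage_algebra2) (auto simp: vimage_def)

lemma erw_past_measurable [measurable]:
  "erw_past \<sigma> \<nu> n \<in> measurable M (count_space UNIV)"
proof -
  have [measurable]: "(\<lambda>w. map (\<lambda>i. \<sigma> i w) [1..<Suc n]) \<in> measurable M (count_space UNIV)"
    "(\<lambda>w. map (\<lambda>i. \<nu> i w) [1..<n]) \<in> measurable M (count_space UNIV)"
    by (intro measurable_list_map step_measurable index_measurable; auto)+
  show ?thesis
    unfolding erw_past_def[abs_def] by measurable
qed

lemma past_subset_events: "sets (past n) \<subseteq> events"
  unfolding sets_past by auto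

lemma past_measurable_determined:
  fixes f :: "'w \<Rightarrow> 'b::countable"
  assumes "\<And>w. w \<in> space M \<Longrightarrow> f w = g (erw_past \<sigma> \<nu> n w)"
  shows "f \<in> measurable (past n) (count_space UNIV)"
proof -
  have "erw_past \<sigma> \<nu> n \<in> measurable (past n) (count_space UNIV)"
    unfolding past_def by (rule measurable_vimage_algebra1) auto
  then have "(\<lambda>w. g (erw_past \<sigma> \<nu> n w)) \<in> measurable (past n) (count_space UNIV)"
    by measurable
  then show ?thesis
    by (subst measurable_cong[OF assms]) auto
qed

lemma walk_eq_sum:
  assumes "w \<in> space M"
  shows "S n w = (\<Sum>i=1..n. \<sigma> i w)"
  by (induction n) (simp_all add: assms walk_0 walk_Suc)

lemma walk_past_measurable:
  assumes "k \<le> n"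
  shows "S k \<in> measurable (past n) (count_space UNIV)"
proof (rule past_measurable_determined)
  fix w assume w: "w \<in> space M"
  have "take k [1..<Suc n] = [1..<Suc k]" using assms by (simp add: take_upt del: upt_Suc)
  then have "sum_list (take k (fst (erw_past \<sigma> \<nu> n w))) = sum_list (map (\<lambda>i. \<sigma> i w) [1..<Suc k])"
    by (simp add: erw_past_def take_map del: upt_Suc)
  also have "\<dots> = (\<Sum>i\<in>set [1..<Suc k]. \<sigma> i w)"
    by (rule sum_list_distinct_conv_sum_set) (rule distinct_upt)
  also have "\<dots> = S k w"
    by (simp add: walk_eq_sum[OF w] atLeastLessThanSuc_atLeastAtMost del: upt_Suc)
  finally show "S k w = (\<lambda>h. sum_list (take k (fst h))) (erw_past \<sigma> \<nu> n w)" by simp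
qed

lemma past_mono:
  assumes "m \<le> n"
  shows "sets (past m) \<subseteq> sets (past n)"
proof
  fix B assume "B \<in> sets (past m)"
  then obtain H where B: "B = {w \<in> space M. erw_past \<sigma> \<nu> m w \<in> H}"
    unfolding sets_past by blast
  have eq: "erw_past \<sigma> \<nu> m w = (take m (fst h), take (m - 1) (snd h))" if "h = erw_past \<sigma> \<nu> n w" for w h
    using assms that
    by (cases "m = 0") (simp_all add: erw_past_def take_map take_upt del: upt_Suc)
  show "B \<in> sets (past n)"
    unfolding sets_past B
    by (rule CollectI, rule exI[of _ "{h. (take m (fst h), take (m - 1) (snd h)) \<in> H}"]) (auto simp: eq)
qed

lemma past_event: "B \<in> sets (past n) \<Longrightarrow> B \<in> events"
  using past_subset_events by blast

lemma walk_measurable [measurable]: "S n \<in> measurable M (count_space UNIV)"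
  using walk_past_measurable[of n n] past_subset_events[of n]
  by (auto simp: measurable_def)

lemma index_in_range:
  assumes "n \<ge> 1"
  shows "AE w in M. \<nu> n w \<in> {1..n}"
proof -
  have [measurable]: "\<nu> n \<in> measurable M (count_space UNIV)" by (rule index_measurable) fact
  have "AE k in distr M (count_space UNIV) (\<nu> n). k \<in> {1..n}"
    unfolding index_uniform[OF assms] using assms by (subst AE_measure_pmf_iff) auto
  then show ?thesis by (subst (asm) AE_distr_iff) auto
qed

lemma recall_prob:
  assumes n: "n \<ge> 1" and k: "k \<in> {1..n}"
  shows "\<P>(w in M. erw_past \<sigma> \<nu> n w = h \<and> \<nu> n w = k) = \<P>(w in M. erw_past \<sigma> \<nu> n w = h) / n"
proof -
  have [measurable]: "\<nu> n \<in> measurable M (count_space UNIV)" by (rule index_measurable) fact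
  have "\<P>(w in M. \<nu> n w = k) = measure (distr M (count_space UNIV) (\<nu> n)) {k}"
    by (subst measure_distr) (auto intro!: arg_cong[where f=prob])
  also have "\<dots> = 1 / n"
    unfolding index_uniform[OF n] using n k by (simp add: measure_pmf_single)
  finally have 1: "\<P>(w in M. \<nu> n w = k) = 1 / n" .
  have "prob ({w \<in> space M. \<nu> n w = k} \<inter> {w \<in> space M. erw_past \<sigma> \<nu> n w = h}) =
      prob {w \<in> space M. \<nu> n w = k} * prob {w \<in> space M. erw_past \<sigma> \<nu> n w = h}"
  proof (rule indep_setD[OF index_indep[OF n]])
    show "{w \<in> space M. \<nu> n w = k} \<in> sets (vimage_algebra (space M) (\<nu> n) (count_space UNIV))"
      by (subst sets_vimage_algebra2) (auto intro!: exI[of _ "{k}"])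
    show "{w \<in> space M. erw_past \<sigma> \<nu> n w = h}
        \<in> sets (vimage_algebra (space M) (erw_past \<sigma> \<nu> n) (count_space UNIV))"
      by (subst sets_vimage_algebra2) (auto intro!: exI[of _ "{h}"])
  qed
  then show ?thesis
    using 1 by (simp add: Int_def conj_ac cong: conj_cong)
qed

text \<open>
  The multiplicative form of a conditional probability also covers conditions of probability zero,
  about which the hypotheses on the steps say nothing.
\<close>

lemma prob_conj_of_cond_prob:
  assumes [measurable]: "Measurable.pred M Q"
    and cond: "\<P>(w in M. Q w) > 0 \<Longrightarrow> \<P>(w in M. R w \<bar> Q w) = c"
  shows "\<P>(w in M. Q w \<and> R w) = c * \<P>(w in M. Q w)"
proof (cases "\<P>(w in M. Q w) = 0")
  case True
  have "\<P>(w in M. Q w \<and> R w) \<le> \<P>(w in M. Q w)"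
    by (intro finite_measure_mono) auto
  with True show ?thesis by (simp add: measure_le_0_iff)
next
  case False
  then have "\<P>(w in M. Q w) > 0" by (simp add: zero_less_measure_iff)
  from cond[OF this] show ?thesis
    using False by (simp add: cond_prob_def field_simps conj_commute)
qed

lemma step_same_prob:
  assumes n: "n \<ge> 1"
  shows "\<P>(w in M. (erw_past \<sigma> \<nu> n w = h \<and> \<nu> n w = k) \<and> \<sigma> (Suc n) w = \<sigma> (\<nu> n w) w)
    = p * \<P>(w in M. erw_past \<sigma> \<nu> n w = h \<and> \<nu> n w = k)"
proof (rule prob_conj_of_cond_prob)
  have [measurable]: "\<nu> n \<in> measurable M (count_space UNIV)" by (rule index_measurable) fact
  show "Measurable.pred M (\<lambda>w. erw_past \<sigma> \<nu> n w = h \<and> \<nu> n w = k)" by measurable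
qed (rule step_same[OF n])

lemma step_opposite_prob:
  assumes n: "n \<ge> 1"
  shows "\<P>(w in M. (erw_past \<sigma> \<nu> n w = h \<and> \<nu> n w = k) \<and> \<sigma> (Suc n) w = - \<sigma> (\<nu> n w) w)
    = (1 - p) * \<P>(w in M. erw_past \<sigma> \<nu> n w = h \<and> \<nu> n w = k)"
proof (rule prob_conj_of_cond_prob)
  have [measurable]: "\<nu> n \<in> measurable M (count_space UNIV)" by (rule index_measurable) fact
  show "Measurable.pred M (\<lambda>w. erw_past \<sigma> \<nu> n w = h \<and> \<nu> n w = k)" by measurable
qed (rule step_opposite[OF n])

definition recalled_step :: "int list \<times> nat list \<Rightarrow> nat \<Rightarrow> int"
  where "recalled_step h k = fst h ! (k - 1)"

lemma recalled_step:
  assumes "k \<in> {1..n}"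
  shows "recalled_step (erw_past \<sigma> \<nu> n w) k = \<sigma> k w"
  using assms unfolding recalled_step_def erw_past_def
  by (simp del: upt_Suc, subst nth_map) (auto simp: nth_upt simp del: upt_Suc)

text \<open>
  The recalled sign is kept with probability \<open>p\<close> and reversed with probability \<open>1 - p\<close>. Writing both
  cases as \<open>(1 + (2 * p - 1) * e * s) / 2\<close>, with \<open>s\<close> the recalled sign, makes the law linear in \<open>s\<close>;
  averaging over the recalled index then produces the position of the walk.
\<close>

lemma step_law_atom:
  assumes n: "n \<ge> 1" and k: "k \<in> {1..n}" and e: "e = 1 \<or> e = -1"
    and h: "recalled_step h k = 1 \<or> recalled_step h k = -1"
  shows "\<P>(w in M. erw_past \<sigma> \<nu> n w = h \<and> \<nu> n w = k \<and> \<sigma> (Suc n) w = e)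
    = (1 + (2 * p - 1) * of_int (e * recalled_step h k)) / 2 * \<P>(w in M. erw_past \<sigma> \<nu> n w = h) / n"
proof -
  have rec: "\<sigma> (\<nu> n w) w = recalled_step h k" if "erw_past \<sigma> \<nu> n w = h" "\<nu> n w = k" for w
    using recalled_step[OF k, of w] that by simp
  show ?thesis
  proof (cases "recalled_step h k = e")
    case True
    have "\<P>(w in M. erw_past \<sigma> \<nu> n w = h \<and> \<nu> n w = k \<and> \<sigma> (Suc n) w = e)
      = \<P>(w in M. (erw_past \<sigma> \<nu> n w = h \<and> \<nu> n w = k) \<and> \<sigma> (Suc n) w = \<sigma> (\<nu> n w) w)"
      using True by (intro arg_cong[where f=prob]) (auto simp: rec)
    also have "\<dots> = p * \<P>(w in M. erw_past \<sigma> \<nu> n w = h) / n"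
      by (simp only: step_same_prob[OF n] recall_prob[OF n k] times_divide_eq_right)
    finally show ?thesis
      using True e by (auto simp: field_simps)
  next
    case False
    have eq: "recalled_step h k = - e" using False e h by auto
    have "\<P>(w in M. erw_past \<sigma> \<nu> n w = h \<and> \<nu> n w = k \<and> \<sigma> (Suc n) w = e)
      = \<P>(w in M. (erw_past \<sigma> \<nu> n w = h \<and> \<nu> n w = k) \<and> \<sigma> (Suc n) w = - \<sigma> (\<nu> n w) w)"
      using eq by (intro arg_cong[where f=prob]) (auto simp: rec)
    also have "\<dots> = (1 - p) * \<P>(w in M. erw_past \<sigma> \<nu> n w = h) / n"
      by (simp only: step_opposite_prob[OF n] recall_prob[OF n k] times_divide_eq_right)
    also have "1 - p = (1 + (2 * p - 1) * of_int (e * recalled_step h k)) / 2"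
      using eq e by (auto simp: field_simps)
    finally show ?thesis .
  qed
qed

text \<open>
  Once the recalled step is a sign, it differs from its opposite, so keeping and reversing are
  disjoint and their conditional probabilities add up to \<open>1\<close>; induction over time does the rest.
\<close>

lemma steps_are_signs:
  assumes "n \<ge> 1"
  shows "AE w in M. \<sigma> n w = 1 \<or> \<sigma> n w = -1"
  using assms
proof (induction n rule: less_induct)
  case (less n)
  show ?case
  proof (cases "n = 1")
    case True
    then show ?thesis using step_1 by (auto intro!: AE_I2)
  next
    case False
    define m where "m = n - 1"
    have m: "m \<ge> 1" "n = Suc m" using False less.prems by (auto simp: m_def)
    have [measurable]: "\<nu> m \<in> measurable M (count_space UNIV)"
      "\<sigma> n \<in> measurable M (count_space UNIV)"
      using m by (auto intro: index_measurable step_measurable)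
    have atom: "AE w in M. erw_past \<sigma> \<nu> m w = h \<and> \<nu> m w = k \<longrightarrow> \<sigma> n w = 1 \<or> \<sigma> n w = -1"
      if k: "k \<in> {1..m}" and h: "recalled_step h k = 1 \<or> recalled_step h k = -1" for h k
    proof -
      let ?A = "{w \<in> space M. erw_past \<sigma> \<nu> m w = h \<and> \<nu> m w = k}"
      let ?E = "\<lambda>e. {w \<in> space M. erw_past \<sigma> \<nu> m w = h \<and> \<nu> m w = k \<and> \<sigma> n w = e}"
      have "prob (?E 1 \<union> ?E (-1)) = prob (?E 1) + prob (?E (-1))"
        by (intro finite_measure_Union) auto
      also have "\<dots> = prob ?A"
        using step_law_atom[OF m(1) k _ h, of 1] step_law_atom[OF m(1) k _ h, of "-1"]
        by (simp add: recall_prob[OF m(1) k] m(2) algebra_simps add_divide_distrib[symmetric] diff_divide_distrib[symmetric])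
      finally have "prob (?A - (?E 1 \<union> ?E (-1))) = 0"
        by (subst finite_measure_Diff) auto
      then have "AE w in M. w \<notin> ?A - (?E 1 \<union> ?E (-1))"
        by (intro AE_not_in) (auto simp: null_sets_def emeasure_eq_measure)
      then show ?thesis using AE_space by eventually_elim auto
    qed
    have "AE w in M. \<forall>h. \<forall>k\<in>{1..m}. recalled_step h k = 1 \<or> recalled_step h k = -1 \<longrightarrow>
        erw_past \<sigma> \<nu> m w = h \<and> \<nu> m w = k \<longrightarrow> \<sigma> n w = 1 \<or> \<sigma> n w = -1"
      unfolding AE_all_countable Ball_def
    proof (intro allI)
      fix h k
      show "AE w in M. k \<in> {1..m} \<longrightarrow> recalled_step h k = 1 \<or> recalled_step h k = -1 \<longrightarrow>
          erw_past \<sigma> \<nu> m w = h \<and> \<nu> m w = k \<longrightarrow> \<sigma> n w = 1 \<or> \<sigma> n w = -1"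
      proof (cases "k \<in> {1..m} \<and> (recalled_step h k = 1 \<or> recalled_step h k = -1)")
        case True
        then show ?thesis using atom[of k h] by (auto elim!: AE_mp intro!: AE_I2)
      qed (auto intro!: AE_I2)
    qed
    moreover have "AE w in M. \<forall>k\<in>{1..m}. \<sigma> k w = 1 \<or> \<sigma> k w = -1"
      using less.IH m by (intro AE_finite_allI) auto
    ultimately show ?thesis
      using index_in_range[OF m(1)]
    proof eventually_elim
      case (elim w)
      have "recalled_step (erw_past \<sigma> \<nu> m w) (\<nu> m w) = \<sigma> (\<nu> m w) w"
        by (rule recalled_step) (rule elim(3))
      then show ?case using elim by metis
    qed
  qed
qed

lemma walk_bounded: "AE w in M. \<bar>S n w\<bar> \<le> int n"
proof -
  have "AE w in M. \<forall>i\<in>{1..n}. \<sigma> i w = 1 \<or> \<sigma> i w = -1"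
    using steps_are_signs by (intro AE_finite_allI) auto
  then show ?thesis
  proof (rule AE_mp, intro AE_I2 impI)
    fix w assume w: "w \<in> space M" "\<forall>i\<in>{1..n}. \<sigma> i w = 1 \<or> \<sigma> i w = -1"
    have "\<bar>S n w\<bar> \<le> (\<Sum>i=1..n. \<bar>\<sigma> i w\<bar>)"
      unfolding walk_eq_sum[OF w(1)] by (rule sum_abs)
    also have "\<dots> \<le> (\<Sum>i=1..n. 1)"
      using w(2) by (intro sum_mono) fastforce
    finally show "\<bar>S n w\<bar> \<le> int n" by simp
  qed
qed

text \<open>
  A finite set which almost surely contains the past, so that an event of the past splits into
  finitely many atoms up to a null set.
\<close>

definition sign_histories :: "nat \<Rightarrow> (int list \<times> nat list) set"
  where "sign_histories n = {xs. set xs \<subseteq> {1, -1} \<and> length xs = n} \<times>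
    {ks. set ks \<subseteq> {..n} \<and> length ks = n - 1}"

lemma finite_sign_histories: "finite (sign_histories n)"
  unfolding sign_histories_def by (intro finite_cartesian_product finite_lists_length_eq) auto

lemma past_in_sign_histories: "AE w in M. erw_past \<sigma> \<nu> n w \<in> sign_histories n"
proof -
  have "AE w in M. \<forall>i\<in>{1..n}. \<sigma> i w = 1 \<or> \<sigma> i w = -1"
    using steps_are_signs by (intro AE_finite_allI) auto
  moreover have "AE w in M. \<forall>i\<in>{1..<n}. \<nu> i w \<in> {1..i}"
    using index_in_range by (intro AE_finite_allI) auto
  ultimately show ?thesis
  proof eventually_elim
    case (elim w)
    have "\<nu> i w \<le> n" if "1 \<le> i" "i < n" for i
      using elim(2) that by (meson atLeastAtMost_iff atLeastLessThan_iff le_trans less_imp_le)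
    then show ?case
      using elim(1) by (auto simp: erw_past_def sign_histories_def simp del: upt_Suc)
  qed
qed

lemma step_law_history:
  assumes n: "n \<ge> 1" and e: "e = 1 \<or> e = -1" and h: "h \<in> sign_histories n"
  shows "\<P>(w in M. erw_past \<sigma> \<nu> n w = h \<and> \<sigma> (Suc n) w = e)
    = (1 + (2 * p - 1) * of_int (e * sum_list (fst h)) / n) / 2 * \<P>(w in M. erw_past \<sigma> \<nu> n w = h)"
proof -
  have [measurable]: "\<nu> n \<in> measurable M (count_space UNIV)"
      "\<sigma> (Suc n) \<in> measurable M (count_space UNIV)"
      using n by (auto intro: index_measurable step_measurable)
  have len: "length (fst h) = n" and signs: "set (fst h) \<subseteq> {1, -1}"
    using h by (auto simp: sign_histories_def)
  have rs: "recalled_step h k = 1 \<or> recalled_step h k = -1" if "k \<in> {1..n}" for k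
  proof -
    have "fst h ! (k - 1) \<in> set (fst h)" using that len by (intro nth_mem) auto
    then show ?thesis using signs by (auto simp: recalled_step_def)
  qed
  have "(\<Sum>k=1..n. recalled_step h k) = (\<Sum>i<n. fst h ! i)"
    unfolding recalled_step_def by (rule sum.reindex_bij_witness[of _ Suc "\<lambda>k. k - 1"]) auto
  then have sum: "(\<Sum>k=1..n. recalled_step h k) = sum_list (fst h)"
    by (simp add: sum_list_sum_nth len atLeast0LessThan)
  have "\<P>(w in M. erw_past \<sigma> \<nu> n w = h \<and> \<sigma> (Suc n) w = e)
      = prob (\<Union>k\<in>{1..n}. {w \<in> space M. erw_past \<sigma> \<nu> n w = h \<and> \<nu> n w = k \<and> \<sigma> (Suc n) w = e})"
    using index_in_range[OF n] by (intro finite_measure_eq_AE) auto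
  also have "\<dots> = (\<Sum>k=1..n. \<P>(w in M. erw_past \<sigma> \<nu> n w = h \<and> \<nu> n w = k \<and> \<sigma> (Suc n) w = e))"
    by (intro finite_measure_finite_Union) (auto simp: disjoint_family_on_def)
  also have "\<dots> = (\<Sum>k=1..n. (1 + (2 * p - 1) * of_int (e * recalled_step h k)) / 2
      * \<P>(w in M. erw_past \<sigma> \<nu> n w = h) / n)"
    by (intro sum.cong refl step_law_atom n e rs)
  also have "\<dots> = (\<Sum>k=1..n. 1 + (2 * p - 1) * of_int e * of_int (recalled_step h k))
      * \<P>(w in M. erw_past \<sigma> \<nu> n w = h) / (2 * n)"
    unfolding sum_distrib_right sum_divide_distrib by (intro sum.cong refl) (simp add: field_simps)
  also have "(\<Sum>k=1..n. 1 + (2 * p - 1) * of_int e * of_int (recalled_step h k) :: real)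
      = n + (2 * p - 1) * of_int e * of_int (sum_list (fst h))"
    unfolding sum[symmetric] by (simp add: sum.distrib sum_distrib_left)
  also have "\<dots> * \<P>(w in M. erw_past \<sigma> \<nu> n w = h) / (2 * n) =
     (1 + (2 * p - 1) * of_int (e * sum_list (fst h)) / n) / 2 * \<P>(w in M. erw_past \<sigma> \<nu> n w = h)"
    using n by (simp add: field_simps)
  finally show ?thesis .
qed

text \<open>
  The walk is a time-inhomogeneous Markov chain with respect to the events of the past: from
  position \<open>s\<close> at time \<open>n\<close> the drift of the next step is \<open>(2 * p - 1) * s / n\<close>.
\<close>

lemma step_law:
  assumes n: "n \<ge> 1" and e: "e = 1 \<or> e = -1"
    and C: "C \<in> sets (past n)" "\<And>w. w \<in> C \<Longrightarrow> S n w = s"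
  shows "prob (C \<inter> {w \<in> space M. \<sigma> (Suc n) w = e}) = (1 + (2 * p - 1) * of_int (e * s) / n) / 2 * prob C"
proof -
  have [measurable]: "\<sigma> (Suc n) \<in> measurable M (count_space UNIV)"
      using n by (auto intro: step_measurable)
  have [measurable]: "C \<in> events" using C past_event by blast
  from C(1) obtain H where H: "C = {w \<in> space M. erw_past \<sigma> \<nu> n w \<in> H}"
    unfolding sets_past by blast
  let ?F = "H \<inter> sign_histories n"
  let ?A = "\<lambda>h. {w \<in> space M. erw_past \<sigma> \<nu> n w = h}"
  let ?E = "\<lambda>h. {w \<in> space M. erw_past \<sigma> \<nu> n w = h \<and> \<sigma> (Suc n) w = e}"
  have fin: "finite ?F" using finite_sign_histories by blast
  have "prob C = prob (\<Union>h\<in>?F. ?A h)"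
    using past_in_sign_histories[of n] by (intro finite_measure_eq_AE) (auto simp: H intro!: sets.finite_UN fin)
  also have "\<dots> = (\<Sum>h\<in>?F. prob (?A h))"
    using fin by (intro finite_measure_finite_Union) (auto simp: disjoint_family_on_def)
  finally have PC: "prob C = (\<Sum>h\<in>?F. prob (?A h))" .
  have hs: "sum_list (fst h) = s" if "?A h \<noteq> {}" "h \<in> H" for h
  proof -
    from that obtain w where w: "w \<in> space M" "erw_past \<sigma> \<nu> n w = h" by blast
    have "sum_list (fst h) = (\<Sum>i\<in>set [1..<Suc n]. \<sigma> i w)"
      unfolding w(2)[symmetric] erw_past_def fst_conv
      by (rule sum_list_distinct_conv_sum_set) (rule distinct_upt)
    also have "\<dots> = S n w"
      by (simp add: walk_eq_sum[OF w(1)] atLeastLessThanSuc_atLeastAtMost del: upt_Suc)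
    also have "\<dots> = s" using C(2) w that by (auto simp: H)
    finally show ?thesis .
  qed
  have "prob (C \<inter> {w \<in> space M. \<sigma> (Suc n) w = e}) = prob (\<Union>h\<in>?F. ?E h)"
    using past_in_sign_histories[of n] by (intro finite_measure_eq_AE) (auto simp: H intro!: sets.finite_UN fin)
  also have "\<dots> = (\<Sum>h\<in>?F. prob (?E h))"
    using fin by (intro finite_measure_finite_Union) (auto simp: disjoint_family_on_def)
  also have "\<dots> = (\<Sum>h\<in>?F. (1 + (2 * p - 1) * of_int (e * s) / n) / 2 * prob (?A h))"
  proof (intro sum.cong refl)
    fix h assume h: "h \<in> ?F"
    show "prob (?E h) = (1 + (2 * p - 1) * of_int (e * s) / n) / 2 * prob (?A h)"
    proof (cases "?A h = {}")
      case True
      then have "?E h = {}" by blast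
      with True show ?thesis by (simp only: measure_empty)
    next
      case False
      then show ?thesis using step_law_history[OF n e, of h] hs[of h] h by simp
    qed
  qed
  also have "\<dots> = (1 + (2 * p - 1) * of_int (e * s) / n) / 2 * prob C"
    unfolding PC sum_distrib_left ..
  finally show ?thesis .
qed

section \<open>Means of functions of the position\<close>

lemma integrable_walk:
  fixes g :: "int \<Rightarrow> real"
  assumes [measurable]: "B \<in> events"
  shows "set_integrable M B (\<lambda>w. g (S n w))"
proof -
  have "AE w in M. norm (indicator B w *\<^sub>R g (S n w)) \<le> (\<Sum>s\<in>{-int n..int n}. \<bar>g s\<bar>)"
    using walk_bounded[of n]
  proof eventually_elim
    case (elim w)
    then have "\<bar>g (S n w)\<bar> \<le> (\<Sum>s\<in>{-int n..int n}. \<bar>g s\<bar>)"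
      by (intro member_le_sum) auto
    then show ?case by (auto simp: indicator_def sum_nonneg)
  qed
  then show ?thesis
    unfolding set_integrable_def by (intro integrable_const_bound) auto
qed

lemma integral_walk_eq_sum:
  fixes g :: "int \<Rightarrow> real"
  assumes [measurable]: "B \<in> events"
  shows "(LINT w:B|M. g (S n w)) = (\<Sum>s\<in>{-int n..int n}. g s * prob (B \<inter> {w \<in> space M. S n w = s}))"
proof -
  have "(LINT w:B|M. g (S n w)) =
      (\<integral>w. (\<Sum>s\<in>{-int n..int n}. g s * indicator (B \<inter> {w \<in> space M. S n w = s}) w) \<partial>M)"
    unfolding set_lebesgue_integral_def
  proof (intro integral_cong_AE)
    show "AE w in M. indicator B w *\<^sub>R g (S n w) =
        (\<Sum>s\<in>{-int n..int n}. g s * indicator (B \<inter> {w \<in> space M. S n w = s}) w)"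
      using walk_bounded[of n] AE_space
    proof eventually_elim
      case (elim w)
      have "(\<Sum>s\<in>{-int n..int n}. g s * indicator (B \<inter> {w \<in> space M. S n w = s}) w)
         = (\<Sum>s\<in>{-int n..int n}. if s = S n w then indicator B w * g s else 0)"
        using elim by (intro sum.cong) (auto simp: indicator_def)
      also have "\<dots> = indicator B w * g (S n w)" using elim by (simp add: abs_le_iff)
      finally show ?case by simp
    qed
  qed measurable
  also have "\<dots> = (\<Sum>s\<in>{-int n..int n}. g s * prob (B \<inter> {w \<in> space M. S n w = s}))"
    by (subst Bochner_Integration.integral_sum) (auto intro!: integrable_mult_right integrable_real_indicator simp: emeasure_eq_measure)
  finally show ?thesis .
qed

lemma integral_step:
  fixes g :: "int \<Rightarrow> real"
  assumes n: "n \<ge> 1" and B: "B \<in> sets (past n)"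
  shows "(LINT w:B|M. g (S (Suc n) w)) = (LINT w:B|M. transition (2 * p - 1) n g (S n w))"
proof -
  have [measurable]: "B \<in> events" using B past_event by blast
  have [measurable]: "\<sigma> (Suc n) \<in> measurable M (count_space UNIV)"
    by (auto intro: step_measurable)
  let ?E = "\<lambda>e. {w \<in> space M. \<sigma> (Suc n) w = e}"
  let ?P = "\<lambda>s. prob (B \<inter> {w \<in> space M. S n w = s})"
  have part: "prob (B \<inter> ?E e \<inter> {w \<in> space M. S n w = s}) = (1 + (2 * p - 1) * of_int (e * s) / n) / 2 * ?P s"
    if "e = 1 \<or> e = -1" for e s
  proof -
    have "{w \<in> space M. S n w = s} \<in> sets (past n)"
      using measurable_sets[OF walk_past_measurable[OF order_refl], of "{s}" n]
      by (simp add: vimage_def Int_def conj_commute)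
    then have C: "B \<inter> {w \<in> space M. S n w = s} \<in> sets (past n)" using B by auto
    show ?thesis using step_law[OF n that C, of s] by (auto simp: Int_ac)
  qed
  have one: "(LINT w:B \<inter> ?E e|M. g (S n w + e)) =
      (\<Sum>s\<in>{-int n..int n}. g (s + e) * ((1 + (2 * p - 1) * of_int (e * s) / n) / 2 * ?P s))"
    if e: "e = 1 \<or> e = -1" for e
    by (subst integral_walk_eq_sum[where g = "\<lambda>s. g (s + e)"]) (auto simp: part[OF e])
  have "(LINT w:B|M. g (S (Suc n) w)) = (LINT w:(B \<inter> ?E 1) \<union> (B \<inter> ?E (-1))|M. g (S (Suc n) w))"
    unfolding set_lebesgue_integral_def
  proof (intro integral_cong_AE)
    show "AE w in M. indicator B w *\<^sub>R g (S (Suc n) w)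
        = indicator ((B \<inter> ?E 1) \<union> (B \<inter> ?E (-1))) w *\<^sub>R g (S (Suc n) w)"
      using steps_are_signs[of "Suc n", simplified] AE_space by eventually_elim (auto simp: indicator_def)
  qed measurable
  also have "\<dots> = (LINT w:B \<inter> ?E 1|M. g (S (Suc n) w)) + (LINT w:B \<inter> ?E (-1)|M. g (S (Suc n) w))"
    by (intro set_integral_Un integrable_walk) auto
  also have "(LINT w:B \<inter> ?E 1|M. g (S (Suc n) w)) = (LINT w:B \<inter> ?E 1|M. g (S n w + 1))"
    by (intro set_lebesgue_integral_cong) (auto simp: walk_Suc)
  also have "(LINT w:B \<inter> ?E (-1)|M. g (S (Suc n) w)) = (LINT w:B \<inter> ?E (-1)|M. g (S n w + -1))"
    by (intro set_lebesgue_integral_cong) (auto simp: walk_Suc)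
  also have "(LINT w:B \<inter> ?E 1|M. g (S n w + 1)) + (LINT w:B \<inter> ?E (-1)|M. g (S n w + -1)) =
      (\<Sum>s\<in>{-int n..int n}. transition (2 * p - 1) n g s * ?P s)"
    unfolding one[OF disjI1[OF refl]] one[OF disjI2[OF refl]] sum.distrib[symmetric]
  proof (intro sum.cong refl)
    fix s :: int
    define \<theta> where "\<theta> = (2 * p - 1) * s / n"
    have \<theta>: "(2 * p - 1) * of_int (1 * s) / n = \<theta>" "(2 * p - 1) * of_int (- 1 * s) / n = - \<theta>"
      by (simp_all add: \<theta>_def)
    show "g (s + 1) * ((1 + (2 * p - 1) * of_int (1 * s) / n) / 2 * ?P s)
        + g (s + - 1) * ((1 + (2 * p - 1) * of_int (- 1 * s) / n) / 2 * ?P s)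
        = transition (2 * p - 1) n g s * ?P s"
      unfolding \<theta> transition_def \<theta>_def[symmetric] by (simp add: algebra_simps)
  qed
  also have "\<dots> = (LINT w:B|M. transition (2 * p - 1) n g (S n w))"
    by (simp add: integral_walk_eq_sum)
  finally show ?thesis .
qed

lemma integral_walk_indicator:
  assumes [measurable]: "B \<in> events"
  shows "(LINT w:B|M. (if Q (S n w) then c else 0)) = c * prob {w \<in> B. Q (S n w)}"
proof -
  have [measurable]: "{w \<in> B. Q (S n w)} \<in> events"
    using sets.sets_into_space[OF assms] sets.Int[OF assms, of "{w \<in> space M. Q (S n w)}"] by (auto simp: Int_def conj_commute cong: conj_cong)
  have "(LINT w:B|M. (if Q (S n w) then c else 0)) = (\<integral>w. c * indicator {w \<in> B. Q (S n w)} w \<partial>M)"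
    unfolding set_lebesgue_integral_def by (intro Bochner_Integration.integral_cong) (auto simp: indicator_def)
  also have "\<dots> = c * prob ({w \<in> B. Q (S n w)} \<inter> space M)" by simp
  also have "{w \<in> B. Q (S n w)} \<inter> space M = {w \<in> B. Q (S n w)}"
    using sets.sets_into_space[OF assms] by blast
  finally show ?thesis .
qed

lemma integral_walk_mono:
  fixes f g :: "int \<Rightarrow> real"
  assumes B: "B \<in> events" and le: "\<And>w. w \<in> B \<Longrightarrow> \<bar>S n w\<bar> \<le> int n \<Longrightarrow> f (S n w) \<le> g (S n w)"
  shows "(LINT w:B|M. f (S n w)) \<le> (LINT w:B|M. g (S n w))"
  unfolding set_lebesgue_integral_def
  using walk_bounded[of n] integrable_walk[OF B, of f n] integrable_walk[OF B, of g n] le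
  by (intro integral_mono_AE) (auto simp: set_integrable_def indicator_def elim!: eventually_mono)

lemma integral_walk_mono_set:
  fixes g :: "int \<Rightarrow> real"
  assumes "A \<in> events" "B \<in> events" "A \<subseteq> B" and nonneg: "\<And>s. g s \<ge> 0"
  shows "(LINT w:A|M. g (S n w)) \<le> (LINT w:B|M. g (S n w))"
  unfolding set_lebesgue_integral_def
  using integrable_walk[OF assms(1), of g n] integrable_walk[OF assms(2), of g n] assms(3) nonneg
  by (intro integral_mono) (auto simp: set_integrable_def indicator_def)

lemma integral_walk_nonneg:
  fixes g :: "int \<Rightarrow> real"
  assumes "\<And>s. g s \<ge> 0"
  shows "(LINT w:B|M. g (S n w)) \<ge> 0"
  unfolding set_lebesgue_integral_def using assms by (intro Bochner_Integration.integral_nonneg) auto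

text \<open>
  The form in which Lyapunov functions are used: a pointwise decrease by \<open>c\<close> on the region \<open>Q\<close>
  becomes a decrease of the mean by \<open>c\<close> times the probability of that region.
\<close>

lemma integral_step_decrease:
  fixes f g :: "int \<Rightarrow> real"
  assumes n: "n \<ge> 1" and B: "B \<in> sets (past n)"
    and le: "\<And>w. w \<in> B \<Longrightarrow> \<bar>S n w\<bar> \<le> int n \<Longrightarrow>
      transition (2 * p - 1) n g (S n w) \<le> f (S n w) - (if Q (S n w) then c else 0)"
  shows "(LINT w:B|M. g (S (Suc n) w)) \<le> (LINT w:B|M. f (S n w)) - c * prob {w \<in> B. Q (S n w)}"
proof -
  have Be: "B \<in> events" using B past_event by blast
  have "(LINT w:B|M. g (S (Suc n) w)) \<le> (LINT w:B|M. f (S n w) - (if Q (S n w) then c else 0))"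
    unfolding integral_step[OF n B]
    by (rule integral_walk_mono[OF Be, where g = "\<lambda>s. f s - (if Q s then c else 0)"]) (rule le)
  also have "\<dots> = (LINT w:B|M. f (S n w)) - (LINT w:B|M. (if Q (S n w) then c else 0))"
    using integrable_walk[OF Be, of f] integrable_walk[OF Be, of "\<lambda>s. if Q s then c else 0"]
    by (intro set_integral_diff) auto
  finally show ?thesis by (simp add: integral_walk_indicator[OF Be])
qed

section \<open>Avoiding a site and visiting it infinitely often\<close>

text \<open>
  The window excludes \<open>n\<close>, so that avoiding \<open>x\<close> up to \<open>Suc n\<close> is an event of the past at time \<open>n\<close>.
\<close>

definition avoiding :: "'w set \<Rightarrow> int \<Rightarrow> nat \<Rightarrow> nat \<Rightarrow> 'w set"
  where "avoiding B x m n = {w \<in> B. \<forall>j\<in>{m..<n}. S j w \<noteq> x}"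

definition never_from :: "int \<Rightarrow> nat \<Rightarrow> 'w set"
  where "never_from x m = {w \<in> space M. \<forall>j\<ge>m. S j w \<noteq> x}"

definition visits_forever :: "int \<Rightarrow> 'w set"
  where "visits_forever x = {w \<in> space M. infinite {n. S n w = x}}"

lemma past_walk_event:
  assumes "B \<in> sets (past n)" "k \<le> n"
  shows "{w \<in> B. Q (S k w)} \<in> sets (past n)"
proof -
  have "{w \<in> B. Q (S k w)} = B \<inter> (S k -` Collect Q \<inter> space (past n))"
    using sets.sets_into_space[OF assms(1)] by auto
  also have "\<dots> \<in> sets (past n)"
    by (rule sets.Int[OF assms(1) measurable_sets[OF walk_past_measurable[OF assms(2)]]]) simp
  finally show ?thesis .
qed

lemma avoiding_in_past:
  assumes "B \<in> sets (past n)" "k \<le> Suc n"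
  shows "avoiding B x m k \<in> sets (past n)"
proof -
  have "avoiding B x m k = B \<inter> {w \<in> space (past n). \<forall>j\<in>{m..<k}. S j w \<noteq> x}"
    using sets.sets_into_space[OF assms(1)] by (auto simp: avoiding_def)
  moreover have "{w \<in> space (past n). \<forall>j\<in>{m..<k}. S j w \<noteq> x} \<in> sets (past n)"
  proof (rule sets.sets_Collect_finite_All)
    fix j assume "j \<in> {m..<k}"
    then have "j \<le> n" using assms by auto
    from past_walk_event[OF sets.top this, of "\<lambda>s. s \<noteq> x"]
    show "{w \<in> space (past n). S j w \<noteq> x} \<in> sets (past n)" .
  qed simp
  ultimately show ?thesis using sets.Int[OF assms(1)] by simp
qed

lemma avoiding_Suc:
  "m \<le> n \<Longrightarrow> avoiding B x m (Suc n) = avoiding B x m n - {w \<in> avoiding B x m n. S n w = x}"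
  by (auto simp: avoiding_def less_Suc_eq)

lemma never_from_event [measurable]: "never_from x m \<in> events"
  unfolding never_from_def by measurable

lemma never_from_subset: "m \<le> n \<Longrightarrow> never_from x m \<subseteq> never_from x n"
  unfolding never_from_def using le_trans by blast

lemma visits_forever_event [measurable]: "visits_forever x \<in> events"
  unfolding visits_forever_def infinite_nat_iff_unbounded by measurable

lemma prob_avoiding_tendsto:
  assumes B: "B \<in> events"
  shows "(\<lambda>n. prob (avoiding B x m n)) \<longlonglongrightarrow> prob (B \<inter> never_from x m)"
proof -
  have "avoiding B x m n = B \<inter> {w \<in> space M. \<forall>j\<in>{m..<n}. S j w \<noteq> x}" for n
    using sets.sets_into_space[OF B] by (auto simp: avoiding_def)
  moreover have "B \<inter> {w \<in> space M. \<forall>j\<in>{m..<n}. S j w \<noteq> x} \<in> events" for n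
    using B by measurable
  ultimately have ev: "avoiding B x m n \<in> events" for n by simp
  have "(\<Inter>n. avoiding B x m n) = B \<inter> never_from x m"
    using sets.sets_into_space[OF B] by (force simp: avoiding_def never_from_def)
  moreover have "(\<lambda>n. prob (avoiding B x m n)) \<longlonglongrightarrow> prob (\<Inter>n. avoiding B x m n)"
    using ev by (intro finite_Lim_measure_decseq) (auto simp: decseq_def avoiding_def)
  ultimately show ?thesis by simp
qed

lemma visits_forever_eq: "visits_forever x = space M - (\<Union>m. never_from x m)"
  unfolding visits_forever_def never_from_def infinite_nat_iff_unbounded_le by auto

text \<open>
  Doob's maximal inequality: the supermartingale is stopped at the first visit to \<open>x\<close>, where it is
  worth at least \<open>v\<close>. Keeping the mean over the paths that have not yet been stopped makes the
  induction over \<open>N\<close> close.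
\<close>

lemma maximal_inequality:
  fixes g :: "nat \<Rightarrow> int \<Rightarrow> real"
  assumes n: "n \<ge> 1" and B: "B \<in> sets (past n)"
    and super: "\<And>k s. k \<ge> n \<Longrightarrow> \<bar>s\<bar> \<le> int k \<Longrightarrow> transition (2 * p - 1) k (g (Suc k)) s \<le> g k s"
    and v: "\<And>k. k \<ge> n \<Longrightarrow> v \<le> g k x"
    and N: "N \<ge> n"
  shows "v * (prob B - prob (avoiding B x n N)) + (LINT w:avoiding B x n N|M. g N (S N w))
    \<le> (LINT w:B|M. g n (S n w))"
  using N
proof (induction N rule: dec_induct)
  case base
  then show ?case by (simp add: avoiding_def)
next
  case (step N)
  let ?A = "avoiding B x n N" and ?A' = "avoiding B x n (Suc N)"
  let ?H = "{w \<in> ?A. S N w = x}"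
  have N1: "N \<ge> 1" using n step by simp
  have BN: "B \<in> sets (past N)" using past_mono[of n N] B step by blast
  have A: "?A \<in> sets (past N)" "?A' \<in> sets (past N)" using avoiding_in_past[OF BN] by auto
  have H: "?H \<in> sets (past N)" using past_walk_event[OF A(1), of N] by auto
  note ev = past_event[OF A(1)] past_event[OF A(2)] past_event[OF H]
  have A': "?A' = ?A - ?H" using step by (intro avoiding_Suc) auto
  have un: "?A = ?A' \<union> ?H" "?A' \<inter> ?H = {}" unfolding A' by auto
  have "prob ?A = prob ?A' + prob ?H"
    by (subst un(1), rule finite_measure_Union) (use ev un in auto)
  moreover have "(LINT w:?A|M. g N (S N w)) = (LINT w:?A'|M. g N (S N w)) + (LINT w:?H|M. g N (S N w))"
    by (subst un(1), rule set_integral_Un) (use ev un in \<open>auto intro: integrable_walk\<close>)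
  moreover have "(LINT w:?A'|M. g (Suc N) (S (Suc N) w)) \<le> (LINT w:?A'|M. g N (S N w))"
    using integral_step_decrease[OF N1 A(2), of "g (Suc N)" "g N" "\<lambda>_. False" 0] super step by simp
  moreover have "v * prob ?H \<le> (LINT w:?H|M. g N (S N w))"
  proof -
    have "v * prob {w \<in> ?H. True} = (LINT w:?H|M. (if True then v else 0))"
      by (rule integral_walk_indicator[OF ev(3), where Q = "\<lambda>_. True", symmetric])
    also have "\<dots> \<le> (LINT w:?H|M. g N (S N w))"
      using v step by (intro integral_walk_mono[OF ev(3), where f = "\<lambda>_. if True then v else 0"]) auto
    finally show ?thesis by simp
  qed
  ultimately show ?case using step.IH by (simp add: algebra_simps)
qed

section \<open>Transience in the superdiffusive regime\<close>

text \<open>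
  A nonnegative Lyapunov function cannot decrease by \<open>c / n\<close> on \<open>Q\<close> forever unless \<open>Q\<close> is
  improbable at arbitrarily late times, and this remains so on every event of the past.
\<close>

lemma exists_time_outside_decrease_region:
  fixes V :: "nat \<Rightarrow> int \<Rightarrow> real"
  assumes m: "m \<ge> 1" and B: "B \<in> sets (past m)" and c: "c > 0" and \<delta>: "\<delta> > 0"
    and V: "\<And>n s. V n s \<ge> 0"
    and dec: "\<And>n s. n \<ge> m \<Longrightarrow> \<bar>s\<bar> \<le> int n \<Longrightarrow>
      transition (2 * p - 1) n (V (Suc n)) s \<le> V n s - (if Q n s then c / n else 0)"
  shows "\<exists>n\<ge>m. prob {w \<in> B. Q n (S n w)} < \<delta>"
proof (rule exists_small_of_harmonic_decrease[OF _ c \<delta>])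
  fix n assume n: "n \<ge> m"
  have Bn: "B \<in> sets (past n)" using past_mono[OF n] B by blast
  show "(LINT w:B|M. V (Suc n) (S (Suc n) w)) \<le> (LINT w:B|M. V n (S n w)) - c / n * prob {w \<in> B. Q n (S n w)}"
    using n m dec[OF n] by (intro integral_step_decrease[OF _ Bn]) auto
qed (use V in \<open>auto intro: integral_walk_nonneg\<close>)

text \<open>
  At a suitable late time the walk has left the diffusive scale with overwhelming probability, so
  that the escape function is at most \<open>1 / (1 + K)\<close>; at a later visit to \<open>x\<close> it would again be almost
  \<open>1\<close>. The maximal inequality bounds the conditional probability of such a visit by the ratio of the
  two values, which does not depend on the event \<open>B\<close> of the past.
\<close>

lemma infinite_visits_deficit:
  assumes p: "p > 3 / 4"
  defines "K \<equiv> (4 * p - 3) / 4"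
  assumes m: "m \<ge> 1" and B: "B \<in> sets (past m)"
  shows "prob (B \<inter> visits_forever x) \<le> 1 / (1 + K / 2) * prob B"
proof -
  define V where "V = escape_fun K"
  have K: "K > 0" "4 * K \<le> 2 * (2 * p - 1) - 1" using p by (auto simp: K_def)
  have V0: "V n s \<ge> 0" for n s using K by (simp add: V_def escape_fun_def)
  let ?c = "K / (4 * (1 + K) ^ 3)"
  have c: "?c > 0" using K by simp
  have "prob (B \<inter> visits_forever x) \<le> 1 / (1 + K / 2) * prob B + \<delta>" if \<delta>: "\<delta> > 0" for \<delta>
  proof -
    obtain n0 :: nat where n0: "(1 + K) / K \<le> n0" using real_arch_simple by blast
    obtain n1 :: nat where n1: "(2 + K) * (real_of_int x)\<^sup>2 \<le> n1" using real_arch_simple by blast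
    let ?m = "max m (max n0 n1)"
    have "\<exists>n\<ge>?m. prob {w \<in> B. (S n w)\<^sup>2 \<le> int n} < \<delta>"
    proof (rule exists_time_outside_decrease_region[where V = V and Q = "\<lambda>n s. s\<^sup>2 \<le> int n", OF _ _ c \<delta> V0])
      show "B \<in> sets (past ?m)" using past_mono[of m ?m] B by auto
      fix n s assume n: "?m \<le> n" "\<bar>s\<bar> \<le> int n"
      then show "transition (2 * p - 1) n (V (Suc n)) s \<le> V n s - (if s\<^sup>2 \<le> int n then ?c / n else 0)"
        unfolding V_def using K m n0 by (intro transition_escape_fun) auto
    qed (use m in simp)
    then obtain n where n: "n \<ge> ?m" and small: "prob {w \<in> B. (S n w)\<^sup>2 \<le> int n} < \<delta>" by blast
    have n': "n \<ge> 1" "(1 + K) / K \<le> n" "(2 + K) * (real_of_int x)\<^sup>2 \<le> n" using n m n0 n1 by auto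
    have Bn: "B \<in> sets (past n)" using past_mono[of m n] B n by auto
    let ?B = "{w \<in> B. \<not> (S n w)\<^sup>2 \<le> int n}" and ?C = "{w \<in> B. (S n w)\<^sup>2 \<le> int n}"
    have B': "?B \<in> sets (past n)" "?C \<in> sets (past n)"
      using past_walk_event[OF Bn order_refl] by auto
    note ev = B'[THEN past_event]
    \<comment> \<open>The value at \<open>x\<close> tends to \<open>1\<close>; the threshold \<open>v\<close> between \<open>1 / (1 + K)\<close> and \<open>1\<close> is reached from \<open>n1\<close> on.\<close>
    define v where "v = (1 + K / 2) / (1 + K)"
    have v: "v > 0" using K by (simp add: v_def)
    have vV: "v \<le> V k x" if "k \<ge> n" for k
    proof -
      have k: "(2 + K) * (real_of_int x)\<^sup>2 \<le> k" "real k > 0" using that n' by auto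
      have "(1 + K / 2) * (k + K * (real_of_int x)\<^sup>2) \<le> k * (1 + K)"
        using mult_left_mono[OF k(1), of "K / 2"] K by (simp add: algebra_simps)
      then show ?thesis using k K
        by (simp add: v_def V_def escape_fun_def divide_le_eq le_divide_eq add_pos_nonneg)
    qed
    have far: "(LINT w:?B|M. V n (S n w)) \<le> 1 / (1 + K) * prob ?B"
    proof -
      have "(LINT w:?B|M. V n (S n w)) \<le> (LINT w:?B|M. (if True then 1 / (1 + K) else 0))"
      proof (rule integral_walk_mono[OF ev(1), where g = "\<lambda>_. if True then 1 / (1 + K) else 0"])
        fix w assume "w \<in> ?B"
        then have "real_of_int (int n) \<le> real_of_int ((S n w)\<^sup>2)" by (simp only: of_int_le_iff) simp
        then have "real n * (1 + K) \<le> n + K * (real_of_int (S n w))\<^sup>2"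
          using K by (simp add: algebra_simps)
        then show "V n (S n w) \<le> (if True then 1 / (1 + K) else 0)"
          using K n' by (simp add: V_def escape_fun_def divide_le_eq le_divide_eq add_pos_nonneg)
      qed
      also have "\<dots> = 1 / (1 + K) * prob {w \<in> ?B. True}"
        by (rule integral_walk_indicator[OF ev(1), where Q = "\<lambda>_. True"])
      finally show ?thesis by simp
    qed
    have avoid: "(1 - 1 / (1 + K / 2)) * prob ?B \<le> prob (avoiding ?B x n N)" if "N \<ge> n" for N
    proof -
      have "v * (prob ?B - prob (avoiding ?B x n N)) + (LINT w:avoiding ?B x n N|M. V N (S N w))
          \<le> (LINT w:?B|M. V n (S n w))"
      proof (rule maximal_inequality[where g = V, OF n'(1) B'(1) _ _ that])
        fix k s assume "n \<le> k" "\<bar>s\<bar> \<le> int k"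
        then have "transition (2 * p - 1) k (V (Suc k)) s \<le> V k s - (if s\<^sup>2 \<le> int k then ?c / k else 0)"
          unfolding V_def using K n' by (intro transition_escape_fun) auto
        also have "\<dots> \<le> V k s"
        proof -
          have "0 \<le> ?c / k" by (rule divide_nonneg_nonneg[OF less_imp_le[OF c]]) simp
          then show ?thesis by simp
        qed
        finally show "transition (2 * p - 1) k (V (Suc k)) s \<le> V k s" .
      qed (rule vV)
      moreover have "(LINT w:avoiding ?B x n N|M. V N (S N w)) \<ge> 0" by (rule integral_walk_nonneg[OF V0])
      ultimately have "v * (prob ?B - prob (avoiding ?B x n N)) \<le> 1 / (1 + K) * prob ?B" using far by linarith
      then have "prob ?B - prob (avoiding ?B x n N) \<le> (1 / (1 + K) * prob ?B) / v"
        by (simp only: pos_le_divide_eq[OF v] mult.commute)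
      also have "\<dots> = 1 / (1 + K / 2) * prob ?B" using K by (simp add: v_def)
      finally show ?thesis by (simp add: algebra_simps)
    qed
    have "(1 - 1 / (1 + K / 2)) * prob ?B \<le> prob (?B \<inter> never_from x n)"
      by (rule tendsto_lowerbound[OF prob_avoiding_tendsto[OF ev(1)]])
        (use avoid in \<open>auto intro: eventually_sequentiallyI\<close>)
    moreover have "prob (?B \<inter> visits_forever x) + prob (?B \<inter> never_from x n) \<le> prob ?B"
    proof -
      have "prob (?B \<inter> visits_forever x) + prob (?B \<inter> never_from x n)
          = prob ((?B \<inter> visits_forever x) \<union> (?B \<inter> never_from x n))"
        using ev by (intro finite_measure_Union[symmetric]) (auto simp: visits_forever_eq)
      also have "\<dots> \<le> prob ?B" using ev by (intro finite_measure_mono) auto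
      finally show ?thesis .
    qed
    ultimately have "prob (?B \<inter> visits_forever x) \<le> 1 / (1 + K / 2) * prob ?B"
      by (simp add: algebra_simps)
    also have "\<dots> \<le> 1 / (1 + K / 2) * prob B"
      using K past_event[OF Bn] by (intro mult_left_mono finite_measure_mono) auto
    finally have near: "prob (?B \<inter> visits_forever x) \<le> 1 / (1 + K / 2) * prob B" .
    have "prob (B \<inter> visits_forever x) \<le> prob (?C \<union> (?B \<inter> visits_forever x))"
      using ev by (intro finite_measure_mono) auto
    also have "\<dots> \<le> prob ?C + prob (?B \<inter> visits_forever x)"
      using ev by (intro measure_Un_le) auto
    finally show ?thesis using near small by linarith
  qed
  then show ?thesis by (rule field_le_epsilon)
qed

text \<open>
  A zero-one argument: infinitely many visits are approximated by the events of the past which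
  say that \<open>x\<close> is visited in a window. Applying the bound to these and letting first the end and
  then the start of the window tend to infinity, the probability is at most \<open>c < 1\<close> times itself.
\<close>

lemma visits_forever_null_of_deficit:
  assumes c: "c < 1"
    and le: "\<And>m B. m \<ge> 1 \<Longrightarrow> B \<in> sets (past m) \<Longrightarrow> prob (B \<inter> visits_forever x) \<le> c * prob B"
  shows "prob (visits_forever x) = 0"
proof -
  have never: "prob (visits_forever x) \<le> c * (1 - prob (never_from x k))" for k
  proof -
    let ?A = "\<lambda>N. avoiding (space M) x k N"
    have A: "?A N \<in> sets (past N)" for N
      using sets.top[of "past N"] by (intro avoiding_in_past) auto
    note Ae = A[THEN past_event]
    have "prob (visits_forever x) \<le> c * (1 - prob (?A N)) + (prob (?A N) - prob (never_from x k))"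
      if "N \<ge> 1" for N
    proof -
      let ?T = "space M - ?A N"
      have sub: "never_from x k \<subseteq> ?A N" by (auto simp: never_from_def avoiding_def)
      have T: "?T \<in> sets (past N)" using sets.compl_sets[OF A, of N] by simp
      \<comment> \<open>Infinitely many visits without one in \<open>{k..<N}\<close> require a first visit at \<open>N\<close> or later, which becomes
        ever less probable as \<open>N\<close> grows.\<close>
      have "prob (visits_forever x) \<le> prob ((?T \<inter> visits_forever x) \<union> (?A N - never_from x k))"
        using Ae past_event[OF T] by (intro finite_measure_mono) (auto simp: visits_forever_eq)
      also have "\<dots> \<le> prob (?T \<inter> visits_forever x) + prob (?A N - never_from x k)"
        using Ae past_event[OF T] by (intro measure_Un_le) auto
      also have "prob (?T \<inter> visits_forever x) \<le> c * prob ?T" by (rule le[OF that T])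
      also have "prob ?T = 1 - prob (?A N)" by (rule prob_compl[OF Ae])
      also have "prob (?A N - never_from x k) = prob (?A N) - prob (never_from x k)"
        using sub Ae by (intro finite_measure_Diff) auto
      finally show ?thesis by simp
    qed
    moreover have "(\<lambda>N. c * (1 - prob (?A N)) + (prob (?A N) - prob (never_from x k)))
        \<longlonglongrightarrow> c * (1 - prob (space M \<inter> never_from x k)) + (prob (space M \<inter> never_from x k) - prob (never_from x k))"
      by (intro tendsto_intros prob_avoiding_tendsto) auto
    moreover have "space M \<inter> never_from x k = never_from x k" by (auto simp: never_from_def)
    ultimately show ?thesis
      by (intro tendsto_lowerbound[of _ _ sequentially]) (auto intro: eventually_sequentiallyI)
  qed
  have "(\<lambda>k. prob (never_from x k)) \<longlonglongrightarrow> prob (\<Union>k. never_from x k)"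
    by (intro finite_Lim_measure_incseq) (auto simp: incseq_def intro: never_from_subset[THEN subsetD])
  then have "(\<lambda>k. c * (1 - prob (never_from x k))) \<longlonglongrightarrow> c * (1 - prob (\<Union>k. never_from x k))"
    by (intro tendsto_intros)
  also have "1 - prob (\<Union>k. never_from x k) = prob (visits_forever x)"
    unfolding visits_forever_eq by (rule prob_compl[symmetric]) auto
  finally have "prob (visits_forever x) \<le> c * prob (visits_forever x)"
    using never by (intro tendsto_lowerbound[of _ _ sequentially]) auto
  then have "(1 - c) * prob (visits_forever x) \<le> 0" by (simp add: algebra_simps)
  then show ?thesis using c by (simp add: mult_le_0_iff measure_le_0_iff)
qed

lemma transient_if_superdiffusive:
  assumes p: "p > 3 / 4"
  shows "transient_walk M S"
  unfolding transient_walk_def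
proof
  fix x
  have "prob (visits_forever x) = 0"
  proof (rule visits_forever_null_of_deficit[OF _ infinite_visits_deficit[OF p]])
    show "1 / (1 + (4 * p - 3) / 4 / 2) < 1" using p by (simp add: field_simps)
  qed
  moreover have "{w \<in> space M. finite {n. S n w = x}} = space M - visits_forever x"
    by (auto simp: visits_forever_def)
  ultimately show "\<P>(w in M. finite {n. S n w = x}) = 1"
    by (simp add: prob_compl)
qed

section \<open>Recurrence in the diffusive and critical regimes\<close>

lemma never_from_null_iff:
  "prob (visits_forever x) = 1 \<longleftrightarrow> (\<forall>m. prob (never_from x m) = 0)"
proof -
  have "prob (visits_forever x) = 1 - prob (\<Union>m. never_from x m)"
    unfolding visits_forever_eq by (rule prob_compl) auto
  moreover have "(\<forall>m. prob (never_from x m) = 0) \<longleftrightarrow> prob (\<Union>m. never_from x m) = 0"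
  proof
    assume "\<forall>m. prob (never_from x m) = 0"
    then have "(\<Union>m. never_from x m) \<in> null_sets M"
      by (intro null_sets_UN) (auto simp: null_sets_def emeasure_eq_measure)
    then show "prob (\<Union>m. never_from x m) = 0" by (rule measure_eq_0_null_sets)
  next
    assume 0: "prob (\<Union>m. never_from x m) = 0"
    have "prob (never_from x m) \<le> prob (\<Union>m. never_from x m)" for m
      by (intro finite_measure_mono) auto
    with 0 show "\<forall>m. prob (never_from x m) = 0" by (simp add: measure_le_0_iff)
  qed
  ultimately show ?thesis by auto
qed

lemma never_from_mono: "m \<le> n \<Longrightarrow> prob (never_from x m) \<le> prob (never_from x n)"
  by (intro finite_measure_mono never_from_subset) auto

text \<open>
  While the origin is avoided, the mean scaled distance stays bounded, so the walk is unlikely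
  to be beyond \<open>R\<close> times the diffusive scale; within that scale the concave function decreases by
  order \<open>1 / n\<close>, so at suitable late times it is unlikely to be there either.
\<close>

lemma origin_visited_forever:
  assumes p: "p \<le> 3 / 4"
  shows "prob (visits_forever 0) = 1"
  unfolding never_from_null_iff
proof
  fix m0 :: nat
  define m where "m = max 3 m0"
  have m: "m \<ge> 3" by (simp add: m_def)
  have a: "2 * p - 1 \<le> 1 / 2" using p by simp
  let ?A = "\<lambda>k. avoiding (space M) 0 m (Suc k)"
  have A: "?A k \<in> sets (past k)" for k
    using sets.top[of "past k"] by (intro avoiding_in_past) auto
  note Ae = A[THEN past_event]
  have A_sub: "?A (Suc k) \<subseteq> ?A k" for k by (auto simp: avoiding_def)
  have nz: "S k w \<noteq> 0" if "w \<in> ?A k" "k \<ge> m" for w k using that by (auto simp: avoiding_def)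
  define E where "E k = (LINT w:?A k|M. scaled_abs k (S k w))" for k
  define U where "U k = (LINT w:?A k|M. concave_fun k (S k w))" for k
  have E_dec: "E (Suc k) \<le> E k" if k: "k \<ge> m" for k
  proof -
    have "E (Suc k) \<le> (LINT w:?A k|M. scaled_abs (Suc k) (S (Suc k) w))"
      unfolding E_def using Ae A_sub spread_pos[of "Suc k"]
      by (intro integral_walk_mono_set) (auto simp: scaled_abs_def)
    also have "\<dots> \<le> (LINT w:?A k|M. scaled_abs k (S k w)) - 0 * prob {w \<in> ?A k. False}"
    proof (rule integral_step_decrease[OF _ A, where Q = "\<lambda>_. False"])
      fix w assume "w \<in> ?A k"
      then show "transition (2 * p - 1) k (scaled_abs (Suc k)) (S k w)
          \<le> scaled_abs k (S k w) - (if False then 0 else 0)"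
        using transition_scaled_abs[OF _ a, of k "S k w"] nz[of w k] k m by simp
    qed (use k m in simp)
    finally show ?thesis by (simp add: E_def)
  qed
  have E_le: "E k \<le> E m" if "k \<ge> m" for k
    using that by (induction k rule: dec_induct) (use E_dec in \<open>auto intro: order_trans\<close>)
  have U_dec: "U (Suc k) \<le> U k - 1 / (2 * (R + 2) ^ 3) / k * prob {w \<in> ?A k. \<bar>S k w\<bar> \<le> R * spread k}"
    if k: "k \<ge> m" and R: "R > 0" for k and R :: real
  proof -
    have "U (Suc k) \<le> (LINT w:?A k|M. concave_fun (Suc k) (S (Suc k) w))"
      unfolding U_def using Ae A_sub spread_pos[of "Suc k"]
      by (intro integral_walk_mono_set) (auto simp: concave_fun_def)
    also have "\<dots> \<le> (LINT w:?A k|M. concave_fun k (S k w))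
        - 1 / (2 * (R + 2) ^ 3) / k * prob {w \<in> ?A k. \<bar>S k w\<bar> \<le> R * spread k}"
    proof (rule integral_step_decrease[OF _ A, where f = "concave_fun k" and g = "concave_fun (Suc k)"
          and Q = "\<lambda>s. real_of_int \<bar>s\<bar> \<le> R * spread k"])
      fix w assume "w \<in> ?A k" "\<bar>S k w\<bar> \<le> int k"
      then show "transition (2 * p - 1) k (concave_fun (Suc k)) (S k w)
          \<le> concave_fun k (S k w) - (if \<bar>S k w\<bar> \<le> R * spread k then 1 / (2 * (R + 2) ^ 3) / k else 0)"
        using nz[of w k] k m R by (intro transition_concave_fun[OF _ a]) auto
    qed (use k m in simp)
    finally show ?thesis by (simp add: U_def)
  qed
  have never: "prob (never_from 0 m) \<le> \<delta> + E m / R" if \<delta>: "\<delta> > 0" and R: "R > 0" for \<delta> R :: real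
  proof -
    have "\<exists>k\<ge>m. prob {w \<in> ?A k. \<bar>S k w\<bar> \<le> R * spread k} < \<delta>"
    proof (rule exists_small_of_harmonic_decrease[where u = U and c = "1 / (2 * (R + 2) ^ 3)", OF _ _ \<delta>])
      show "U k \<ge> 0" if "k \<ge> m" for k
        unfolding U_def using that m spread_pos[of k] by (intro integral_walk_nonneg) (auto simp: concave_fun_def)
    qed (use U_dec R in \<open>simp_all\<close>)
    then obtain k where k: "k \<ge> m" and small: "prob {w \<in> ?A k. \<bar>S k w\<bar> \<le> R * spread k} < \<delta>" by blast
    have d: "spread k > 0" using k m by (intro spread_pos) auto
    let ?F = "{w \<in> ?A k. \<not> \<bar>S k w\<bar> \<le> R * spread k}" and ?N = "{w \<in> ?A k. \<bar>S k w\<bar> \<le> R * spread k}"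
    have ev: "?F \<in> events" "?N \<in> events"
      by (rule past_event[OF past_walk_event[OF A order_refl]])+
    have "R * prob ?F = (LINT w:?A k|M. (if \<not> \<bar>S k w\<bar> \<le> R * spread k then R else 0))"
      by (rule integral_walk_indicator[OF Ae, where Q = "\<lambda>s. \<not> real_of_int \<bar>s\<bar> \<le> R * spread k", symmetric])
    also have "\<dots> \<le> E k"
      unfolding E_def
    proof (rule integral_walk_mono[OF Ae, where f = "\<lambda>s. if \<not> real_of_int \<bar>s\<bar> \<le> R * spread k then R else 0"
          and g = "scaled_abs k"])
      fix w
      show "(if \<not> \<bar>S k w\<bar> \<le> R * spread k then R else 0) \<le> scaled_abs k (S k w)"
        using d by (simp add: scaled_abs_def pos_le_divide_eq)
    qed
    also have "\<dots> \<le> E m" by (rule E_le[OF k])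
    finally have F: "prob ?F \<le> E m / R" using R by (simp add: pos_le_divide_eq mult.commute)
    have "prob (never_from 0 m) \<le> prob (?N \<union> ?F)"
      using ev by (intro finite_measure_mono) (auto simp: never_from_def avoiding_def)
    also have "\<dots> \<le> prob ?N + prob ?F"
      using ev by (intro measure_Un_le) auto
    finally show ?thesis using F small by linarith
  qed
  have "prob (never_from 0 m) \<le> 0 + \<epsilon>" if \<epsilon>: "\<epsilon> > 0" for \<epsilon>
  proof -
    have E0: "E m \<ge> 0" unfolding E_def using spread_pos[of m] m
      by (intro integral_walk_nonneg) (auto simp: scaled_abs_def)
    define R where "R = 2 * (E m + 1) / \<epsilon>"
    have R: "R > 0" using E0 \<epsilon> by (simp add: R_def)
    have "E m / R \<le> \<epsilon> / 2" using E0 \<epsilon> by (simp add: R_def field_simps)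
    then show ?thesis using never[of "\<epsilon> / 2" R] \<epsilon> R by linarith
  qed
  then have "prob (never_from 0 m) \<le> 0" by (rule field_le_epsilon)
  then show "prob (never_from 0 m0) = 0"
    using never_from_mono[of m0 m 0] by (simp add: m_def measure_le_0_iff)
qed

text \<open>
  From \<open>x\<close> the next step leads to \<open>x + e\<close> with probability at least \<open>1 / 4\<close> at late times. Each visit
  to \<open>x\<close> while \<open>x + e\<close> is avoided therefore costs a quarter of its probability, so that these
  probabilities are summable, and by Borel and Cantelli only finitely many such visits occur.
\<close>

lemma neighbour_visited_forever:
  assumes x: "prob (visits_forever x) = 1" and e: "e = 1 \<or> e = -1"
  shows "prob (visits_forever (x + e)) = 1"
  unfolding never_from_null_iff
proof
  fix k0 :: nat
  define k where "k = max 1 k0"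
  let ?A = "\<lambda>n. avoiding (space M) (x + e) k (Suc n)"
  let ?C = "\<lambda>n. {w \<in> ?A n. S n w = x}"
  let ?E = "\<lambda>n. {w \<in> space M. \<sigma> (Suc n) w = e}"
  have A: "?A n \<in> sets (past n)" for n
    using sets.top[of "past n"] by (intro avoiding_in_past) auto
  have C: "?C n \<in> sets (past n)" for n by (rule past_walk_event[OF A order_refl])
  note Ae = A[THEN past_event] and Ce = C[THEN past_event]
  \<comment> \<open>From time \<open>2 * \<bar>x\<bar>\<close> on the drift at \<open>x\<close> is at most \<open>1 / 2\<close> in absolute value.\<close>
  define n0 where "n0 = max k (2 * nat \<bar>x\<bar>)"
  have dec: "prob (?A (Suc n)) \<le> prob (?A n) - 1 / 4 * prob (?C n)" if n: "n \<ge> n0" for n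
  proof -
    have n1: "n \<ge> 1" "n \<ge> k" and nx: "2 * \<bar>real_of_int x\<bar> \<le> n" using n by (auto simp: n0_def k_def)
    have [measurable]: "\<sigma> (Suc n) \<in> measurable M (count_space UNIV)" by (auto intro: step_measurable)
    have CE: "?C n \<inter> ?E n \<in> events" using Ce by measurable
    have "1 / 4 \<le> (1 + (2 * p - 1) * of_int (e * x) / n) / 2"
    proof -
      have "\<bar>(2 * p - 1) * of_int (e * x)\<bar> \<le> 1 * \<bar>real_of_int x\<bar>"
        unfolding abs_mult using parameter e by (intro mult_mono) (auto simp: abs_mult)
      then have "- (real n / 2) \<le> (2 * p - 1) * of_int (e * x)" using nx by linarith
      then show ?thesis using n1 by (simp add: field_simps)
    qed
    then have "1 / 4 * prob (?C n) \<le> (1 + (2 * p - 1) * of_int (e * x) / n) / 2 * prob (?C n)"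
      by (intro mult_right_mono) auto
    also have "\<dots> = prob (?C n \<inter> ?E n)"
      by (rule step_law[OF n1(1) e C, symmetric]) simp
    finally have quarter: "1 / 4 * prob (?C n) \<le> prob (?C n \<inter> ?E n)" .
    have "w \<notin> ?C n \<inter> ?E n" if "w \<in> ?A (Suc n)" for w
    proof
      assume "w \<in> ?C n \<inter> ?E n"
      then have "S (Suc n) w = x + e" by (auto simp: walk_Suc)
      moreover have "S (Suc n) w \<noteq> x + e" using that n1 by (auto simp: avoiding_def)
      ultimately show False by simp
    qed
    then have "prob (?A (Suc n)) \<le> prob (?A n - (?C n \<inter> ?E n))"
      using Ae CE by (intro finite_measure_mono) (auto simp: avoiding_def)
    also have "\<dots> = prob (?A n) - prob (?C n \<inter> ?E n)"
      using Ae CE by (intro finite_measure_Diff) auto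
    finally show ?thesis using quarter by simp
  qed
  have "(\<Sum>i<j. prob (?C (i + n0))) \<le> 4 * (prob (?A n0) - prob (?A (j + n0)))" for j
  proof (induction j)
    case (Suc j)
    then show ?case using dec[of "j + n0"] by simp
  qed simp
  moreover have "4 * (prob (?A n0) - prob (?A (j + n0))) \<le> 4" for j
  proof -
    have "prob (?A n0) - prob (?A (j + n0)) \<le> 1 - 0" by (intro diff_mono) auto
    then show ?thesis by simp
  qed
  ultimately have "(\<Sum>i<j. prob (?C (i + n0))) \<le> 4" for j
    by (rule order_trans)
  then have "summable (\<lambda>i. prob (?C (i + n0)))"
    by (intro summableI_nonneg_bounded) auto
  then have "summable (\<lambda>n. prob (?C n))" by (rule summable_iff_shift[of "\<lambda>n. prob (?C n)" n0, THEN iffD1])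
  then have "AE w in M. eventually (\<lambda>n. w \<in> space M - ?C n) sequentially"
    using Ce by (intro borel_cantelli_AE1) (auto simp: emeasure_eq_measure)
  moreover have "AE w in M. w \<in> visits_forever x"
    using x by (subst (asm) prob_eq_1) auto
  ultimately have "AE w in M. w \<notin> never_from (x + e) k"
  proof eventually_elim
    case (elim w)
    show ?case
    proof
      assume never: "w \<in> never_from (x + e) k"
      then have "w \<in> ?A n" for n by (auto simp: never_from_def avoiding_def)
      then obtain N where N: "\<And>n. n \<ge> N \<Longrightarrow> S n w \<noteq> x"
        using elim(1) unfolding eventually_sequentially by auto
      moreover obtain n where "n \<ge> N" "S n w = x"
        using elim(2) unfolding visits_forever_def infinite_nat_iff_unbounded_le by auto
      ultimately show False by blast
    qed
  qed
  then have "prob (never_from (x + e) k) = 0"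
    by (subst (asm) AE_iff_measurable[OF never_from_event]) (auto simp: emeasure_eq_measure never_from_def)
  then show "prob (never_from (x + e) k0) = 0"
    using never_from_mono[of k0 k "x + e"] by (simp add: k_def measure_le_0_iff)
qed

lemma recurrent_if_not_superdiffusive:
  assumes p: "p \<le> 3 / 4"
  shows "recurrent_walk M S"
proof -
  have "prob (visits_forever x) = 1" for x
  proof (induction x rule: int_induct[of _ 0])
    case base
    show ?case by (rule origin_visited_forever[OF p])
  next
    case (step1 i)
    then show ?case using neighbour_visited_forever[of i 1] by simp
  next
    case (step2 i)
    then show ?case using neighbour_visited_forever[of i "-1"] by simp
  qed
  then show ?thesis by (simp add: recurrent_walk_def visits_forever_def)
qed

end

theorem theorem1p4:
  fixes M :: "'w measure" and p :: real
    and \<sigma> :: "nat \<Rightarrow> 'w \<Rightarrow> int" and \<nu> :: "nat \<Rightarrow> 'w \<Rightarrow> nat" and S :: "nat \<Rightarrow> 'w \<Rightarrow> int"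
  assumes "elephant_random_walk M p \<sigma> \<nu> S"
  shows "(p \<le> 3 / 4 \<longrightarrow> recurrent_walk M S) \<and> (p > 3 / 4 \<longrightarrow> transient_walk M S)"
proof -
  interpret elephant_random_walk M p \<sigma> \<nu> S by fact
  show ?thesis
    using recurrent_if_not_superdiffusive transient_if_superdiffusive by blast
qed

end
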